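(* Let $w=(w_n)_{n\in\mathbb{Z}}$ be a sequence of nonzero scalars and let $X$ be an admissible Banach sequence space for the bilateral weighted backward shift $B_w$. Then $B_w:X\to X$ has the shadowing property if and only if one of the following conditions holds: \begin{itemize} \item[(I)] $\displaystyle\lim_{n\to \infty}\sup_{k\in \mathbb{Z}}\left( \left| w_{k}\cdots w_{k+n-1} \right|\frac{\left\| e_{k} \right\|}{\left\| e_{k+n} \right\|} \right)^{\frac{1}{n}}<1;$ \item[(II)] $\displaystyle\lim_{n\to \infty}\inf_{k\in \mathbb{Z}}\left( \left| w_{k}\cdots w_{k+n-1} \right|\frac{\left\| e_{k} \right\|}{\left\| e_{k+n} \right\|} \right)^{\frac{1}{n}}>1;$ \item[(III)] $\displaystyle\lim_{n\to \infty}\sup_{k\in \mathbb{N}}\left( \left| w_{-k-1}\cdots w_{-k-n} \right|\frac{\left\| e_{-k-n} \right\|}{\left\| e_{-k} \right\|} \right)^{\frac{1}{n}}<1$ and $\displaystyle\lim_{n\to \infty}\inf_{k\in \mathbb{N}}\left( \left| w_{k}\cdots w_{k+n-1} \right|\frac{\left\| e_{k} \right\|}{\left\| e_{k+n} \right\|} \right)^{\frac{1}{n}}>1$. \end{itemize}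
   Context: $\mathbb{K}$ is $\mathbb{R}$ or $\mathbb{C}$; $\mathbb{N}=\{1,2,\dots\}$. An (invertible) operator on a Banach space is a continuous (invertible) linear self-map. Shadowing: a homeomorphism $f$ of a metric space $(Y,d)$ has the shadowing property if for every $\varepsilon>0$ there is $\delta>0$ such that for every sequence $(x_j)_{j\in\mathbb{Z}}$ in $Y$ with $d(f(x_j),x_{j+1})\le\delta$ for all $j\in\mathbb{Z}$ (a $\delta$-pseudotrajectory) there is $x\in Y$ with $d(x_j,f^j(x))<\varepsilon$ for all $j\in\mathbb{Z}$. For an invertible operator on a Banach space, the metric is the one given by the norm. Banach sequence space over $\mathbb{Z}$: a Banach space $(X,\|\cdot\|)$ which is a vector subspace of $\mathbb{K}^{\mathbb{Z}}$ with continuous inclusion $X\to\mathbb{K}^{\mathbb{Z}}$ (product topology). Let $e_n=(\delta_{n,j})_{j\in\mathbb{Z}}$. Given nonzero scalars $w=(w_n)_{n\in\mathbb{Z}}$, $B_w((x_n)_{n\in\mathbb{Z}})=(w_nx_{n+1})_{n\in\mathbb{Z}}$. Condition (CB): $e_n\in X$ for all $n\in\mathbb{Z}$, and $X$ is the topological direct sum $X=M\oplus N$, where $M=\{(x_n)\in X: x_n=0 \ \forall n>0\}$ and $N=\{(x_n)\in X: x_n=0\ \forall n\le 0\}$. Admissible Banach sequence space for $B_w$: a Banach sequence space $X$ over $\mathbb{Z}$ satisfying (CB), such that $B_w$ is an invertible operator on $X$ and the following hold: (C1) for each $m\in\mathbb{Z}$ and $x=(x_j)_{j\in\mathbb{Z}}\in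 X$, $|x_m|\,\|e_m\|\le\|x\|$; (C2) for each $n\in\mathbb{N}$ and $x\in X$: $\|(B_w)^n(x)\|\le \sup_{k\in\mathbb{Z},\,x_k\ne0}|w_{k-n}\cdots w_{k-1}|\frac{\|e_{k-n}\|}{\|e_k\|}\,\|x\|$ and $\|(B_w^{-1})^n(x)\|\le \sup_{k\in\mathbb{Z},\,x_k\ne0}\frac{1}{|w_k\cdots w_{k+n-1}|}\frac{\|e_{k+n}\|}{\|e_k\|}\,\|x\|$. *)

theory Defs
  imports "HOL-Analysis.Analysis" "HOL-Library.Function_Algebras"
begin

text \<open>
  The scalar field is a type of class \<open>real_normed_field\<close>. By the Gelfand--Mazur theorem
  the real and the complex numbers are, up to isometric isomorphism, the only such fields.
  A sequence space is a carrier set \<open>X\<close> of bilateral sequences together with a function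
  \<open>nrm\<close>, whose values outside \<open>X\<close> are irrelevant.
\<close>

definition seq_scale :: "'k \<Rightarrow> (int \<Rightarrow> 'k) \<Rightarrow> int \<Rightarrow> 'k::times" where
  "seq_scale c x = (\<lambda>n. c * x n)"

definition unit_seq :: "int \<Rightarrow> int \<Rightarrow> 'k::zero_neq_one" where
  "unit_seq n = (\<lambda>j. if j = n then 1 else 0)"

definition weighted_shift :: "(int \<Rightarrow> 'k) \<Rightarrow> (int \<Rightarrow> 'k) \<Rightarrow> int \<Rightarrow> 'k::times" where
  "weighted_shift w x = (\<lambda>n. w n * x (n + 1))"

text \<open>The value off \<open>X\<close> is set to 0 because \<open>Metric_space\<close> requires nonnegativity
  and symmetry on the whole type.\<close>

definition norm_dist ::
    "(int \<Rightarrow> 'k::real_normed_field) set \<Rightarrow> ((int \<Rightarrow> 'k) \<Rightarrow> real) \<Rightarrow>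
     (int \<Rightarrow> 'k) \<Rightarrow> (int \<Rightarrow> 'k) \<Rightarrow> real" where
  "norm_dist X nrm x y = (if x \<in> X \<and> y \<in> X then nrm (x - y) else 0)"

abbreviation norm_topology ::
    "(int \<Rightarrow> 'k::real_normed_field) set \<Rightarrow> ((int \<Rightarrow> 'k) \<Rightarrow> real) \<Rightarrow> (int \<Rightarrow> 'k) topology" where
  "norm_topology X nrm \<equiv> Metric_space.mtopology X (norm_dist X nrm)"

locale normed_sequence_space =
  fixes X :: "(int \<Rightarrow> 'k::real_normed_field) set"
    and nrm :: "(int \<Rightarrow> 'k) \<Rightarrow> real"
  assumes subspace: "module.subspace seq_scale X"
    and nrm_nonneg: "x \<in> X \<Longrightarrow> 0 \<le> nrm x"
    and nrm_eq_0_iff: "x \<in> X \<Longrightarrow> nrm x = 0 \<longleftrightarrow> x = 0"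
    and nrm_scale: "x \<in> X \<Longrightarrow> nrm (seq_scale c x) = norm c * nrm x"
    and nrm_triangle: "x \<in> X \<Longrightarrow> y \<in> X \<Longrightarrow> nrm (x + y) \<le> nrm x + nrm y"

lemma vector_space_seq_scale: "vector_space (seq_scale :: 'k::field \<Rightarrow> _)"
  by unfold_locales (auto simp: seq_scale_def fun_eq_iff algebra_simps)

lemma (in normed_sequence_space) Metric_space_norm_dist: "Metric_space X (norm_dist X nrm)"
proof -
  interpret vector_space "seq_scale :: 'k \<Rightarrow> _"
    by (rule vector_space_seq_scale)
  have diff: "x - y \<in> X" if "x \<in> X" "y \<in> X" for x y
    using subspace that by (rule subspace_diff)
  have sym: "nrm (x - y) = nrm (y - x)" if "x \<in> X" "y \<in> X" for x y
  proof -
    have "y - x = seq_scale (- 1) (x - y)"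
      by (simp add: seq_scale_def fun_eq_iff)
    then show ?thesis
      using nrm_scale[OF diff[OF that], of "- 1"] by simp
  qed
  show ?thesis
  proof
    fix x y
    show "0 \<le> norm_dist X nrm x y"
      by (simp add: norm_dist_def nrm_nonneg diff)
    show "norm_dist X nrm x y = norm_dist X nrm y x"
      using sym by (auto simp: norm_dist_def)
  next
    fix x y assume "x \<in> X" "y \<in> X"
    then show "norm_dist X nrm x y = 0 \<longleftrightarrow> x = y"
      by (simp add: norm_dist_def nrm_eq_0_iff diff)
  next
    fix x y z assume "x \<in> X" "y \<in> X" "z \<in> X"
    then show "norm_dist X nrm x z \<le> norm_dist X nrm x y + norm_dist X nrm y z"
      using nrm_triangle[of "x - y" "y - z"] by (simp add: norm_dist_def diff)
  qed
qed

locale banach_sequence_space = normed_sequence_space +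
  assumes complete: "Metric_space.mcomplete X (norm_dist X nrm)"
    and continuous_inclusion:
      "continuous_map (norm_topology X nrm) (product_topology (\<lambda>_. euclidean) UNIV) (\<lambda>x. x)"

definition topological_direct_sum :: "'a::plus topology \<Rightarrow> 'a set \<Rightarrow> 'a set \<Rightarrow> bool" where
  "topological_direct_sum T M N \<longleftrightarrow>
     M \<subseteq> topspace T \<and> N \<subseteq> topspace T \<and>
     homeomorphic_map (prod_topology (subtopology T M) (subtopology T N)) T (\<lambda>(x, y). x + y)"

definition invertible_operator ::
    "(int \<Rightarrow> 'k::real_normed_field) set \<Rightarrow> ((int \<Rightarrow> 'k) \<Rightarrow> real) \<Rightarrow>
     ((int \<Rightarrow> 'k) \<Rightarrow> int \<Rightarrow> 'k) \<Rightarrow> bool" where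
  "invertible_operator X nrm F \<longleftrightarrow>
     (\<forall>x\<in>X. \<forall>y\<in>X. F (x + y) = F x + F y) \<and>
     (\<forall>c. \<forall>x\<in>X. F (seq_scale c x) = seq_scale c (F x)) \<and>
     homeomorphic_map (norm_topology X nrm) (norm_topology X nrm) F"

text \<open>The suprema in \<open>C2_shift\<close> and \<open>C2_inverse\<close> are taken in the extended reals; the empty
  supremum \<open>-\<infinity>\<close> occurs for \<open>x = 0\<close> only, where it is multiplied by 0.\<close>

locale admissible_sequence_space = banach_sequence_space X nrm
  for w :: "int \<Rightarrow> 'k::real_normed_field" and X nrm +
  assumes unit_seq_mem: "unit_seq n \<in> X"
    and direct_sum: "topological_direct_sum (norm_topology X nrm)
          {x \<in> X. \<forall>n>0. x n = 0} {x \<in> X. \<forall>n\<le>0. x n = 0}"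
    and invertible: "invertible_operator X nrm (weighted_shift w)"
    and C1: "x \<in> X \<Longrightarrow> norm (x m) * nrm (unit_seq m) \<le> nrm x"
    and C2_shift: "n \<ge> 1 \<Longrightarrow> x \<in> X \<Longrightarrow>
          ereal (nrm ((weighted_shift w ^^ n) x)) \<le>
            (SUP k\<in>{k. x k \<noteq> 0}. ereal (norm (\<Prod>j\<in>{k - int n..k - 1}. w j) *
               (nrm (unit_seq (k - int n)) / nrm (unit_seq k)))) * ereal (nrm x)"
    and C2_inverse: "n \<ge> 1 \<Longrightarrow> x \<in> X \<Longrightarrow>
          ereal (nrm ((inv_into X (weighted_shift w) ^^ n) x)) \<le>
            (SUP k\<in>{k. x k \<noteq> 0}. ereal (1 / norm (\<Prod>j\<in>{k..k + int n - 1}. w j) *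
               (nrm (unit_seq (k + int n)) / nrm (unit_seq k)))) * ereal (nrm x)"

definition int_iterate :: "'a set \<Rightarrow> ('a \<Rightarrow> 'a) \<Rightarrow> int \<Rightarrow> 'a \<Rightarrow> 'a" where
  "int_iterate Y f j =
     (if j \<ge> 0 then f ^^ nat j else inv_into Y f ^^ nat (- j))"

definition shadowing_property :: "'a set \<Rightarrow> ('a \<Rightarrow> 'a \<Rightarrow> real) \<Rightarrow> ('a \<Rightarrow> 'a) \<Rightarrow> bool" where
  "shadowing_property Y d f \<longleftrightarrow>
     (\<forall>\<epsilon>>0. \<exists>\<delta>>0. \<forall>x :: int \<Rightarrow> 'a.
        (\<forall>j. x j \<in> Y) \<and> (\<forall>j. d (f (x j)) (x (j + 1)) \<le> \<delta>) \<longrightarrow>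
        (\<exists>y\<in>Y. \<forall>j. d (x j) (int_iterate Y f j y) < \<epsilon>))"

end

theory Submission
  imports Defs
begin

text \<open>
  Let \<open>W\<close> be the two-sided product of the weights, so that \<open>W (k + 1) = w k * W k\<close>. The shift maps
  the vectors \<open>unit_seq k / W k\<close> to each other, and the number
  \<open>scaled_weight k = norm (W k) / nrm (unit_seq k)\<close> is the reciprocal norm of the \<open>k\<close>-th of them. All
  products in the three conditions are quotients \<open>scaled_weight (k + n) / scaled_weight k\<close>.
  The logarithm of the supremum over \<open>k\<close> of such quotients, or of their inverses, is subadditive in
  \<open>n\<close>. By Fekete's lemma the limits of the \<open>n\<close>-th roots therefore exist, and the conditions say
  that \<open>scaled_weight\<close> decays geometrically and uniformly on all integers, grows so on all integers, or
  grows so from the origin towards both ends. This is \<open>uniform_growth\<close>, and the translation is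
  \<open>lim_SUP_less_1_iff_uniform_growth\<close> and \<open>lim_INF_greater_1_iff_uniform_growth\<close>.

  Shadowing is used for one pseudotrajectory only, which runs along the vectors above and
  jumps at each time by \<open>\<delta>\<close> times the next vector, normalised. A true trajectory has a constant
  coefficient along these vectors. So the sequence \<open>T\<close> with increments \<open>\<delta> * scaled_weight k\<close> differs
  from a constant by at most \<open>scaled_weight k\<close> at each \<open>k\<close>. An increasing sequence whose increments
  control its size in this way grows geometrically where it is above the constant, and approaches
  the constant geometrically where it is below. The three conditions correspond to the constant
  being above all values, below all values, or passed once (\<open>growth_trichotomy\<close>).

  Conversely, each condition splits the indices into a left part and a right part, one of which may
  be empty. On sequences supported in the left part the positive iterates of the shift contract
  geometrically, on sequences supported in the right part the negative iterates do. The
  restrictions to the two parts are bounded, because the space is the topological direct sum of the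
  sequences that vanish at positive and at nonpositive indices. For such a splitting the errors
  of a pseudotrajectory are summed up by two geometric series, and subtracting their sum
  gives a true trajectory (\<open>shadowing_if_splitting\<close>).
\<close>

section \<open>Growth rates of subadditive sequences\<close>

text \<open>Fekete's lemma. Writing \<open>n = q * m + r\<close> with \<open>r < m\<close> gives \<open>u n / n \<le> u m / m + O(1/n)\<close>
  for every fixed \<open>m\<close>, so the ratios converge to their infimum.\<close>

lemma fekete:
  fixes u :: "nat \<Rightarrow> real"
  assumes sub: "\<And>m n. u (m + n) \<le> u m + u n"
    and bound: "\<And>n. \<bar>u n\<bar> \<le> real n * c"
  shows "convergent (\<lambda>n. u n / real n)"
proof -
  define l where "l = (INF n\<in>{1..}. u n / real n)"
  have c: "0 \<le> c"
    using bound[of 1] by simp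
  have "- c \<le> u n / real n" if "n \<ge> 1" for n
    using bound[of n] that by (simp add: field_simps abs_le_iff)
  then have bdd: "bdd_below ((\<lambda>n. u n / real n) ` {1..})"
    by (intro bdd_belowI[of _ "- c"]) auto
  have mult: "u (q * m) \<le> real q * u m" for q m
  proof (induction q)
    case 0
    show ?case using bound[of 0] by simp
  next
    case (Suc q)
    have "u (Suc q * m) \<le> u m + u (q * m)"
      using sub[of m "q * m"] by simp
    with Suc show ?case by (simp add: algebra_simps)
  qed
  have upper: "u n / real n \<le> u m / real m + 2 * real m * c / real n" if m: "m \<ge> 1" and n: "n \<ge> 1" for m n
  proof -
    have "u n \<le> u ((n div m) * m) + u (n mod m)"
      using sub[of "(n div m) * m" "n mod m"] by simp
    also have "\<dots> \<le> real (n div m) * u m + u (n mod m)"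
      using mult by simp
    also have "real (n div m) * u m = real n * (u m / real m) - real (n mod m) * (u m / real m)"
    proof -
      have "real n = real (n div m) * real m + real (n mod m)"
        by (metis div_mult_mod_eq of_nat_add of_nat_mult)
      with m show ?thesis by (simp add: field_simps)
    qed
    also have "\<bar>u m / real m\<bar> \<le> c"
      using bound[of m] m by (simp add: field_simps)
    then have "- (real (n mod m) * (u m / real m)) \<le> real m * c"
      using m c mult_mono[of "real (n mod m)" "real m" "- (u m / real m)" c]
      by (smt (verit, best) mod_less_divisor mult_minus_right of_nat_0_le_iff of_nat_less_iff
          less_le_trans mult_left_mono mult_right_mono zero_less_one)
    then have "real n * (u m / real m) - real (n mod m) * (u m / real m) + u (n mod m)
        \<le> real n * (u m / real m) + 2 * real m * c"
    proof -
      have "u (n mod m) \<le> real (n mod m) * c"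
        using bound[of "n mod m"] by simp
      also have "\<dots> \<le> real m * c"
        using m c by (intro mult_right_mono) (auto intro: less_imp_le)
      finally show ?thesis
        using \<open>- (real (n mod m) * (u m / real m)) \<le> real m * c\<close> by simp
    qed
    finally show ?thesis using n by (simp add: field_simps)
  qed
  have "(\<lambda>n. u n / real n) \<longlonglongrightarrow> l"
  proof (rule LIMSEQ_I)
    fix e :: real assume e: "0 < e"
    have "\<exists>x\<in>(\<lambda>n. u n / real n) ` {1..}. x < l + e / 2"
      by (rule cInf_lessD) (use e in \<open>auto simp: l_def\<close>)
    then obtain m where m: "m \<ge> 1" "u m / real m < l + e / 2"
      by auto
    obtain N where N: "4 * real m * c / e < real N"
      using reals_Archimedean2 by blast
    show "\<exists>N. \<forall>n\<ge>N. norm (u n / real n - l) < e"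
    proof (intro exI allI impI)
      fix n assume n: "n \<ge> max N 1"
      have "4 * real m * c / e < real n"
        using n N by linarith
      then have "2 * real m * c / real n < e / 2"
        using n e by (simp add: field_simps)
      moreover have "u n / real n \<le> u m / real m + 2 * real m * c / real n"
        using upper m n by simp
      moreover have "l \<le> u n / real n"
        unfolding l_def using n by (intro cINF_lower bdd) auto
      ultimately show "norm (u n / real n - l) < e"
        using m e by simp
    qed
  qed
  then show ?thesis by (rule convergentI)
qed

section \<open>Root limits and uniform growth\<close>

definition uniform_growth :: "(int \<Rightarrow> real) \<Rightarrow> int set \<Rightarrow> bool" where
  "uniform_growth b A \<longleftrightarrow>
     (\<exists>C>0. \<exists>t. 0 < t \<and> t < 1 \<and> (\<forall>k\<in>A. \<forall>n::nat. b k \<le> C * t ^ n * b (k + int n)))"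

context
  fixes b :: "int \<Rightarrow> real" and D :: real and A :: "int set"
  assumes pos: "\<And>k. 0 < b k"
    and ratio_up: "\<And>k. b (k + 1) \<le> D * b k"
    and ratio_down: "\<And>k. b k \<le> D * b (k + 1)"
    and nonempty: "A \<noteq> {}"
    and closed: "\<And>k n. k \<in> A \<Longrightarrow> k + int n \<in> A"
begin

lemma ratio_bound_ge_1: "1 \<le> D"
proof -
  have D: "0 < D"
    using pos[of 0] pos[of "0 + 1"] ratio_up[of 0] by (smt (verit) mult_nonpos_nonneg)
  have "b 0 \<le> D * (D * b 0)"
    using ratio_down[of 0] ratio_up[of 0] D by (smt (verit) mult_left_mono)
  then have "1 \<le> D * D"
    using pos[of 0] by (simp add: mult.assoc[symmetric])
  then show ?thesis
    using D by (smt (verit) mult_le_one mult_less_cancel_right2 mult_less_cancel_left2)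
qed

lemma ratio_bound_iterated:
  shows "b (k + int n) \<le> D ^ n * b k" and "b k \<le> D ^ n * b (k + int n)"
proof (induction n)
  case (Suc n)
  have eq: "k + int (Suc n) = (k + int n) + 1" by simp
  case 1
  have "b (k + int (Suc n)) \<le> D * b (k + int n)"
    unfolding eq by (rule ratio_up)
  also have "\<dots> \<le> D * (D ^ n * b k)"
    using Suc(1) ratio_bound_ge_1 by (intro mult_left_mono) auto
  finally show ?case by (simp add: mult.assoc)
  case 2
  have "b k \<le> D ^ n * b (k + int n)" by (rule Suc(2))
  also have "\<dots> \<le> D ^ n * (D * b (k + int (Suc n)))"
    unfolding eq using ratio_bound_ge_1 by (intro mult_left_mono ratio_down) auto
  finally show ?case by (simp add: ac_simps)
qed auto

text \<open>The finitely many small \<open>n\<close> are absorbed in the constant of \<open>uniform_growth\<close>.\<close>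

lemma uniform_growth_if_eventually:
  assumes t: "0 < t" "t < 1" and ev: "\<forall>\<^sub>F n in sequentially. \<forall>k\<in>A. b k \<le> t ^ n * b (k + int n)"
  shows "uniform_growth b A"
proof -
  obtain N where N: "\<And>n k. n \<ge> N \<Longrightarrow> k \<in> A \<Longrightarrow> b k \<le> t ^ n * b (k + int n)"
    using ev by (auto simp: eventually_sequentially)
  define C where "C = (D / t) ^ N"
  have Dt: "1 \<le> D / t"
    using t ratio_bound_ge_1 by simp
  have "b k \<le> C * t ^ n * b (k + int n)" if k: "k \<in> A" for k n
  proof (cases "n \<ge> N")
    case True
    have "1 * (t ^ n * b (k + int n)) \<le> C * (t ^ n * b (k + int n))"
      using Dt t pos[of "k + int n"] unfolding C_def
      by (intro mult_right_mono one_le_power) (auto intro: less_imp_le)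
    with N[OF True k] show ?thesis by (simp add: mult.assoc)
  next
    case False
    have "D ^ n = (D / t) ^ n * t ^ n"
      using t by (simp add: power_divide)
    also have "\<dots> \<le> C * t ^ n"
      unfolding C_def using False Dt t by (intro mult_right_mono power_increasing) auto
    finally have "D ^ n * b (k + int n) \<le> C * t ^ n * b (k + int n)"
      using pos[of "k + int n"] by (simp add: mult_right_mono)
    with ratio_bound_iterated(2)[of k n] show ?thesis by simp
  qed
  moreover have "C > 0"
    unfolding C_def using Dt by (intro zero_less_power) linarith
  ultimately show ?thesis
    unfolding uniform_growth_def using t by blast
qed

text \<open>The logarithm of the worst ratio over \<open>n\<close> steps is subadditive in \<open>n\<close>, so the limits of
  the \<open>n\<close>-th roots exist automatically, and only their sizes carry information.\<close>

definition worst_log_ratio :: "nat \<Rightarrow> real" where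
  "worst_log_ratio n = (SUP k\<in>A. ln (b k / b (k + int n)))"

lemma log_ratio_bound: "\<bar>ln (b k / b (k + int n))\<bar> \<le> real n * ln D"
proof -
  have D: "0 < D ^ n" using ratio_bound_ge_1 by simp
  have "b k / b (k + int n) \<le> D ^ n"
    using ratio_bound_iterated(2)[of k n] pos[of "k + int n"] by (simp add: field_simps)
  then have "ln (b k / b (k + int n)) \<le> ln (D ^ n)"
    using pos D by (subst ln_le_cancel_iff) auto
  moreover have "inverse (D ^ n) \<le> b k / b (k + int n)"
    using ratio_bound_iterated(1)[of k n] pos[of "k + int n"] D by (simp add: field_simps)
  then have "ln (inverse (D ^ n)) \<le> ln (b k / b (k + int n))"
    using pos D by (subst ln_le_cancel_iff) auto
  ultimately show ?thesis
    using ratio_bound_ge_1 by (simp add: ln_realpow ln_inverse abs_le_iff)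
qed

lemma log_ratio_bdd_above: "bdd_above ((\<lambda>k. ln (b k / b (k + int n))) ` A)"
  by (rule bdd_aboveI[of _ "real n * ln D"]) (use log_ratio_bound abs_le_D1 in blast)

lemma log_ratio_le_worst: "k \<in> A \<Longrightarrow> ln (b k / b (k + int n)) \<le> worst_log_ratio n"
  unfolding worst_log_ratio_def by (rule cSUP_upper[OF _ log_ratio_bdd_above])

lemma worst_log_ratio_converges: "convergent (\<lambda>n. worst_log_ratio n / real n)"
proof (rule fekete)
  fix m n
  show "worst_log_ratio (m + n) \<le> worst_log_ratio m + worst_log_ratio n"
    unfolding worst_log_ratio_def[of "m + n"]
  proof (rule cSUP_least[OF nonempty])
    fix k assume k: "k \<in> A"
    have "ln (b k / b (k + int (m + n))) =
        ln (b k / b (k + int m)) + ln (b (k + int m) / b (k + int m + int n))"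
      using pos[of k] pos[of "k + int m"] pos[of "k + int m + int n"] by (simp add: ln_div add.assoc)
    also have "\<dots> \<le> worst_log_ratio m + worst_log_ratio n"
      using k closed by (intro add_mono log_ratio_le_worst) auto
    finally show "ln (b k / b (k + int (m + n))) \<le> worst_log_ratio m + worst_log_ratio n" .
  qed
next
  fix n
  obtain k where k: "k \<in> A" using nonempty by blast
  have "worst_log_ratio n \<le> real n * ln D"
    unfolding worst_log_ratio_def
    by (rule cSUP_least[OF nonempty]) (use log_ratio_bound abs_le_D1 in blast)
  moreover have "- (real n * ln D) \<le> worst_log_ratio n"
    using log_ratio_bound[of k n] log_ratio_le_worst[OF k, of n] by linarith
  ultimately show "\<bar>worst_log_ratio n\<bar> \<le> real n * ln D" by linarith
qed

lemma lim_worst_log_ratio_neg: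
  assumes "uniform_growth b A" and "(\<lambda>n. worst_log_ratio n / real n) \<longlonglongrightarrow> l"
  shows "l < 0"
proof -
  obtain C t where C: "C > 0" and t: "0 < t" "t < 1"
    and growth: "\<And>k n. k \<in> A \<Longrightarrow> b k \<le> C * t ^ n * b (k + int n)"
    using assms(1) unfolding uniform_growth_def by blast
  have "worst_log_ratio n \<le> ln C + real n * ln t" for n
    unfolding worst_log_ratio_def
  proof (rule cSUP_least[OF nonempty])
    fix k assume k: "k \<in> A"
    have "b k / b (k + int n) \<le> C * t ^ n"
      using growth[OF k, of n] pos[of "k + int n"] by (simp add: field_simps)
    then have "ln (b k / b (k + int n)) \<le> ln (C * t ^ n)"
      using pos C t by (subst ln_le_cancel_iff) auto
    also have "\<dots> = ln C + real n * ln t"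
      using C t by (simp add: ln_mult ln_realpow)
    finally show "ln (b k / b (k + int n)) \<le> ln C + real n * ln t" .
  qed
  then have "\<forall>\<^sub>F n in sequentially. worst_log_ratio n / real n \<le> ln C / real n + ln t"
    by (intro eventually_sequentiallyI[of 1]) (simp add: field_simps)
  moreover have "(\<lambda>n. ln C / real n + ln t) \<longlonglongrightarrow> 0 + ln t"
    by (intro tendsto_add lim_const_over_n tendsto_const)
  ultimately have "l \<le> 0 + ln t"
    using assms(2) by (intro tendsto_le[of sequentially]) auto
  with t show ?thesis by (smt (verit) ln_less_zero)
qed

lemma powr_eq_exp_ln_div: "(b k / b (k + int n)) powr (1 / real n) = exp (ln (b k / b (k + int n)) / real n)"
  using pos[of k] pos[of "k + int n"] by (simp add: powr_def)

lemma SUP_root_ratio: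
  "(SUP k\<in>A. ereal ((b k / b (k + int n)) powr (1 / real n))) = ereal (exp (worst_log_ratio n / real n))"
proof -
  have "ereal (exp (worst_log_ratio n / real n)) =
      (SUP s\<in>(\<lambda>k. ln (b k / b (k + int n))) ` A. ereal (exp (s / real n)))"
    unfolding worst_log_ratio_def
    by (rule continuous_at_Sup_mono)
      (use nonempty log_ratio_bdd_above in
        \<open>auto simp: mono_def divide_inverse mult_right_mono continuous_within intro!: tendsto_intros\<close>)
  then show ?thesis by (simp add: powr_eq_exp_ln_div image_image)
qed

lemma INF_root_ratio:
  "(INF k\<in>A. ereal ((b (k + int n) / b k) powr (1 / real n))) = ereal (exp (- (worst_log_ratio n / real n)))"
proof -
  have inv: "(b (k + int n) / b k) powr (1 / real n) = exp (- (ln (b k / b (k + int n)) / real n))" for k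
    using pos[of k] pos[of "k + int n"] by (simp add: powr_def ln_div diff_divide_distrib)
  have "ereal (exp (- (worst_log_ratio n / real n))) =
      (INF s\<in>(\<lambda>k. ln (b k / b (k + int n))) ` A. ereal (exp (- (s / real n))))"
    unfolding worst_log_ratio_def
    by (rule continuous_at_Sup_antimono)
      (use nonempty log_ratio_bdd_above in
        \<open>auto simp: antimono_def divide_inverse mult_right_mono continuous_within intro!: tendsto_intros\<close>)
  then show ?thesis by (simp add: inv image_image)
qed

lemma uniform_growth_if_lim_neg:
  assumes "(\<lambda>n. worst_log_ratio n / real n) \<longlonglongrightarrow> l" and "l < 0"
  shows "uniform_growth b A"
proof (rule uniform_growth_if_eventually)
  show "0 < exp (l / 2)" "exp (l / 2) < 1"
    using assms(2) by auto
  have "\<forall>\<^sub>F n in sequentially. worst_log_ratio n / real n < l / 2"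
    using assms by (intro order_tendstoD) auto
  then show "\<forall>\<^sub>F n in sequentially. \<forall>k\<in>A. b k \<le> exp (l / 2) ^ n * b (k + int n)"
    using eventually_ge_at_top[of 1]
  proof eventually_elim
    case (elim n)
    show ?case
    proof
      fix k assume "k \<in> A"
      then have "ln (b k / b (k + int n)) \<le> real n * (l / 2)"
        using log_ratio_le_worst[of k n] elim by (simp add: field_simps)
      then have "b k / b (k + int n) \<le> exp (real n * (l / 2))"
        using pos by (metis divide_pos_pos exp_le_cancel_iff exp_ln)
      then show "b k \<le> exp (l / 2) ^ n * b (k + int n)"
        using pos[of "k + int n"] by (simp add: field_simps exp_of_nat_mult[symmetric])
    qed
  qed
qed

theorem lim_SUP_less_1_iff_uniform_growth:
  "(\<exists>L<1. (\<lambda>n. SUP k\<in>A. ereal ((b k / b (k + int n)) powr (1 / real n))) \<longlonglongrightarrow> L)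
    \<longleftrightarrow> uniform_growth b A"
proof -
  obtain l where l: "(\<lambda>n. worst_log_ratio n / real n) \<longlonglongrightarrow> l"
    using worst_log_ratio_converges by (auto simp: convergent_def)
  have "(\<lambda>n. SUP k\<in>A. ereal ((b k / b (k + int n)) powr (1 / real n))) \<longlonglongrightarrow> ereal (exp l)"
    unfolding SUP_root_ratio by (intro tendsto_intros l)
  then have "(\<exists>L<1. (\<lambda>n. SUP k\<in>A. ereal ((b k / b (k + int n)) powr (1 / real n))) \<longlonglongrightarrow> L)
      \<longleftrightarrow> ereal (exp l) < 1"
    using LIMSEQ_unique by blast
  also have "\<dots> \<longleftrightarrow> l < 0" by simp
  finally show ?thesis
    using lim_worst_log_ratio_neg uniform_growth_if_lim_neg l by blast
qed

theorem lim_INF_greater_1_iff_uniform_growth: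
  "(\<exists>L>1. (\<lambda>n. INF k\<in>A. ereal ((b (k + int n) / b k) powr (1 / real n))) \<longlonglongrightarrow> L)
    \<longleftrightarrow> uniform_growth b A"
proof -
  obtain l where l: "(\<lambda>n. worst_log_ratio n / real n) \<longlonglongrightarrow> l"
    using worst_log_ratio_converges by (auto simp: convergent_def)
  have "(\<lambda>n. INF k\<in>A. ereal ((b (k + int n) / b k) powr (1 / real n))) \<longlonglongrightarrow> ereal (exp (- l))"
    unfolding INF_root_ratio by (intro tendsto_intros l)
  then have "(\<exists>L>1. (\<lambda>n. INF k\<in>A. ereal ((b (k + int n) / b k) powr (1 / real n))) \<longlonglongrightarrow> L)
      \<longleftrightarrow> ereal (exp (- l)) > 1"
    using LIMSEQ_unique by blast
  also have "\<dots> \<longleftrightarrow> l < 0" by simp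
  finally show ?thesis
    using lim_worst_log_ratio_neg uniform_growth_if_lim_neg l by blast
qed

end

section \<open>A trichotomy for positive sequences\<close>

text \<open>Where \<open>r\<close> is nonnegative, \<open>r\<close> grows at least like \<open>(1 + \<delta>) ^ n\<close>, because
  \<open>r (k + 1) - r k = \<delta> * b k \<ge> \<delta> * r k\<close>; and \<open>b\<close> lies between \<open>r k\<close> and \<open>r (k + 1) / \<delta>\<close>.\<close>

lemma uniform_growth_if_nonneg:
  fixes b r :: "int \<Rightarrow> real"
  assumes \<delta>: "0 < \<delta>"
    and step: "\<And>k. r (k + 1) = r k + \<delta> * b k" and bound: "\<And>k. \<bar>r k\<bar> \<le> b k"
    and nonneg: "\<And>k. k \<in> A \<Longrightarrow> 0 \<le> r k"
  shows "uniform_growth b A"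
proof -
  have bnn: "0 \<le> b k" for k using bound[of k] by linarith
  have main: "b k \<le> (1 + \<delta>) / \<delta> * (1 / (1 + \<delta>)) ^ n * b (k + int n)" if k: "k \<in> A" for k n
  proof -
    have r: "\<delta> * b k * (1 + \<delta>) ^ n \<le> r (k + int (Suc n))" for n
    proof (induction n)
      case 0
      then show ?case using step[of k] nonneg[OF k] by (simp add: add.commute)
    next
      case (Suc n)
      have "\<delta> * b k * (1 + \<delta>) ^ Suc n \<le> (1 + \<delta>) * r (k + int (Suc n))"
        using Suc \<delta> mult_left_mono[OF Suc, of "1 + \<delta>"] by (simp add: ac_simps)
      also have "\<dots> = r (k + int (Suc n)) + \<delta> * r (k + int (Suc n))"
        by (simp add: algebra_simps)
      also have "\<dots> \<le> r (k + int (Suc n)) + \<delta> * b (k + int (Suc n))"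
        using bound[of "k + int (Suc n)"] \<delta> by (intro add_left_mono mult_left_mono) auto
      also have "\<dots> = r (k + int (Suc (Suc n)))"
        using step[of "k + int (Suc n)"] by (simp add: ac_simps)
      finally show ?case .
    qed
    have "\<delta> * b k * (1 + \<delta>) ^ n \<le> (1 + \<delta>) * b (k + int n)"
    proof (cases n)
      case 0
      then show ?thesis using bnn \<delta> by (simp add: mult_right_mono)
    next
      case (Suc m)
      have "\<delta> * b k * (1 + \<delta>) ^ m \<le> b (k + int n)"
        using r[of m] bound[of "k + int n"] Suc by simp
      from mult_left_mono[OF this, of "1 + \<delta>"] show ?thesis
        using Suc \<delta> by (simp add: ac_simps)
    qed
    then show ?thesis
      using \<delta> by (simp add: field_simps)
  qed
  show ?thesis
    unfolding uniform_growth_def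
    by (rule exI[of _ "(1 + \<delta>) / \<delta>"], intro conjI exI[of _ "1 / (1 + \<delta>)"] ballI allI main)
      (use \<delta> in auto)
qed

text \<open>Where \<open>r\<close> is nonpositive, one step to the right multiplies \<open>- r\<close> by at most \<open>1 - \<delta>\<close>. That \<open>r\<close> is
  still nonpositive one step further right gives \<open>\<delta> * b (- k) \<le> - r (- k)\<close>.\<close>

lemma uniform_decay_if_nonpos:
  fixes b r :: "int \<Rightarrow> real"
  assumes \<delta>: "0 < \<delta>" "\<delta> < 1"
    and step: "\<And>k. r (k + 1) = r k + \<delta> * b k" and bound: "\<And>k. \<bar>r k\<bar> \<le> b k"
    and nonpos: "\<And>k. k \<in> A \<Longrightarrow> r (1 - k) \<le> 0"
  shows "uniform_growth (\<lambda>k. b (- k)) A"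
proof -
  have main: "b (- k) \<le> 1 / \<delta> * (1 - \<delta>) ^ n * b (- (k + int n))" if k: "k \<in> A" for k n
  proof -
    have r: "\<delta> * b (- k) \<le> (1 - \<delta>) ^ n * (- r (- (k + int n)))" for n
    proof (induction n)
      case 0
      then show ?case using step[of "- k"] nonpos[OF k] by (simp add: add.commute)
    next
      case (Suc n)
      let ?c = "- (k + int (Suc n))"
      have eq: "?c + 1 = - (k + int n)" by simp
      have "- r ?c \<le> b ?c"
        using bound[of ?c] by linarith
      then have "- r (- (k + int n)) \<le> (1 - \<delta>) * (- r ?c)"
        using step[of ?c, unfolded eq] mult_left_mono[of "- r ?c" "b ?c" \<delta>] \<delta>
        by (simp add: algebra_simps)
      then have "(1 - \<delta>) ^ n * (- r (- (k + int n))) \<le> (1 - \<delta>) ^ n * ((1 - \<delta>) * (- r ?c))"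
        using \<delta> by (intro mult_left_mono) auto
      with Suc show ?case by (simp only: power_Suc2 mult.assoc)
    qed
    have "- r (- (k + int n)) \<le> b (- (k + int n))"
      using bound[of "- (k + int n)"] by linarith
    then have "\<delta> * b (- k) \<le> (1 - \<delta>) ^ n * b (- (k + int n))"
      using r[of n] mult_left_mono[of "- r (- (k + int n))" "b (- (k + int n))" "(1 - \<delta>) ^ n"] \<delta>
      by simp
    then show ?thesis using \<delta> by (simp add: field_simps)
  qed
  show ?thesis
    unfolding uniform_growth_def
    by (rule exI[of _ "1 / \<delta>"], intro conjI exI[of _ "1 - \<delta>"] ballI allI main)
      (use \<delta> in auto)
qed

lemma uniform_growth_mono: "uniform_growth b A \<Longrightarrow> A' \<subseteq> A \<Longrightarrow> uniform_growth b A'"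
  unfolding uniform_growth_def by blast

text \<open>Finitely many indices only change the constant, so a half-line may begin anywhere.\<close>

lemma uniform_growth_extend:
  assumes pos: "\<And>k. 0 < b k" and growth: "uniform_growth b {J + 1..}"
  shows "uniform_growth b {J..}"
proof -
  obtain C t where C: "C > 0" and t: "0 < t" "t < 1"
    and gr: "\<And>k n. k \<in> {J + 1..} \<Longrightarrow> b k \<le> C * t ^ n * b (k + int n)"
    using growth unfolding uniform_growth_def by blast
  define C' where "C' = max (max 1 C) (b J / b (J + 1) * C / t)"
  have le: "b k \<le> C' * t ^ n * b (k + int n)" if b: "b k \<le> E * t ^ n * b (k + int n)" and E: "E \<le> C'" for k n E
  proof -
    have "E * t ^ n * b (k + int n) \<le> C' * t ^ n * b (k + int n)"
      using E t pos[of "k + int n"] by (intro mult_right_mono) auto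
    with b show ?thesis by linarith
  qed
  have "b k \<le> C' * t ^ n * b (k + int n)" if k: "k \<in> {J..}" for k n
  proof (cases "k = J")
    case False
    then show ?thesis
      using le[OF gr] k by (simp add: C'_def)
  next
    case True
    show ?thesis
    proof (cases n)
      case 0
      then show ?thesis using le[of k 1 0] by (simp add: C'_def)
    next
      case (Suc m)
      have "b J = b J / b (J + 1) * b (J + 1)"
        using pos[of "J + 1"] by simp
      also have "\<dots> \<le> b J / b (J + 1) * (C * t ^ m * b (J + 1 + int m))"
        using pos[of "J + 1"] pos[of J] by (intro mult_left_mono gr) auto
      also have "\<dots> = b J / b (J + 1) * C / t * t ^ n * b (k + int n)"
        using Suc True t by (simp add: ac_simps)
      finally show ?thesis
        using le[of k "b J / b (J + 1) * C / t" n] True by (simp add: C'_def)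
    qed
  qed
  moreover have "C' > 0" by (simp add: C'_def)
  ultimately show ?thesis
    unfolding uniform_growth_def using t by blast
qed

lemma uniform_growth_move:
  assumes pos: "\<And>k. 0 < b k" and growth: "uniform_growth b {J..}"
  shows "uniform_growth b {J'..}"
proof (cases "J' \<le> J")
  case True
  then show ?thesis
  proof (induction J' rule: int_le_induct)
    case (step i)
    then show ?case using uniform_growth_extend[of b "i - 1"] pos by simp
  qed (rule growth)
next
  case False
  then show ?thesis by (intro uniform_growth_mono[OF growth]) auto
qed

text \<open>The points \<open>T k\<close> of the real line lie in the balls of radius \<open>b k\<close> around the point \<open>- y\<close>
  of the field. By the triangle inequality the intervals of radius \<open>b k\<close> around \<open>T k\<close> meet pairwise,
  hence they have a common real point \<open>\<rho>\<close>. The increasing sequence \<open>T - \<rho>\<close> is nonnegative, nonpositive,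
  or changes its sign once from negative to positive, which gives the three cases. A sequence \<open>b\<close>
  which tends to \<open>0\<close> at both ends is excluded by the direction of the sign change.\<close>

lemma growth_trichotomy:
  fixes b T :: "int \<Rightarrow> real" and y :: "'k::real_normed_field"
  assumes pos: "\<And>k. 0 < b k" and \<delta>: "0 < \<delta>" "\<delta> < 1"
    and step: "\<And>k. T (k + 1) = T k + \<delta> * b k"
    and near: "\<And>k. norm (of_real (T k) + y) \<le> b k"
  shows "uniform_growth (\<lambda>k. b (- k)) UNIV \<or> uniform_growth b UNIV \<or>
    uniform_growth (\<lambda>k. b (- k)) {1..} \<and> uniform_growth b {1..}"
proof -
  have pairwise: "T i - b i \<le> T k + b k" for i k
  proof -
    have "norm (of_real (T i - T k) :: 'k) \<le> norm (of_real (T i) + y) + norm (of_real (T k) + y)"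
      using norm_triangle_ineq4[of "of_real (T i) + y" "of_real (T k) + y"] by simp
    also have "\<dots> \<le> b i + b k" by (intro add_mono near)
    finally show ?thesis by (simp only: norm_of_real abs_le_iff) linarith
  qed
  define \<rho> where "\<rho> = (SUP i. T i - b i)"
  have low: "T k - b k \<le> \<rho>" for k
    unfolding \<rho>_def by (rule cSUP_upper) (auto intro!: bdd_aboveI[of _ "T 0 + b 0"] pairwise)
  have high: "\<rho> \<le> T k + b k" for k
    unfolding \<rho>_def by (rule cSUP_least) (auto intro: pairwise)
  define r where "r k = T k - \<rho>" for k
  have rstep: "r (k + 1) = r k + \<delta> * b k" for k
    by (simp add: r_def step)
  have rbound: "\<bar>r k\<bar> \<le> b k" for k
    using low[of k] high[of k] by (simp add: r_def abs_le_iff)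
  have mono: "r i \<le> r j" if "i \<le> j" for i j
    using that
  proof (induction j rule: int_ge_induct)
    case (step j)
    then show ?case using rstep[of j] pos[of j] \<delta> by (smt (verit) mult_pos_pos)
  qed simp
  consider (nonneg) "\<forall>k. 0 \<le> r k" | (nonpos) "\<forall>k. r k \<le> 0"
    | (change) i j where "r i < 0" "0 < r j"
    by (meson not_le)
  then show ?thesis
  proof cases
    case nonneg
    then show ?thesis using uniform_growth_if_nonneg[where r = r, OF \<delta>(1) rstep rbound] by blast
  next
    case nonpos
    then show ?thesis using uniform_decay_if_nonpos[where r = r, OF \<delta> rstep rbound] by blast
  next
    case change
    have "uniform_growth b {j..}"
    proof (rule uniform_growth_if_nonneg[where r = r, OF \<delta>(1) rstep rbound])
      fix k assume "k \<in> {j..}"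
      then show "0 \<le> r k" using mono[of j k] change by simp
    qed
    moreover have "uniform_growth (\<lambda>k. b (- k)) {1 - i..}"
    proof (rule uniform_decay_if_nonpos[where r = r, OF \<delta> rstep rbound])
      fix k assume "k \<in> {1 - i..}"
      then show "r (1 - k) \<le> 0" using mono[of "1 - k" i] change by simp
    qed
    ultimately show ?thesis
      using uniform_growth_move[of b] uniform_growth_move[of "\<lambda>k. b (- k)"] pos by blast
  qed
qed

section \<open>Linear maps and series in sequence spaces\<close>

context normed_sequence_space
begin

interpretation seq: vector_space "seq_scale :: 'k \<Rightarrow> _"
  by (rule vector_space_seq_scale)

interpretation metric: Metric_space X "norm_dist X nrm"
  by (rule Metric_space_norm_dist)

lemma zero_mem: "0 \<in> X"
  using subspace by (rule seq.subspace_0)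

lemma add_mem: "x \<in> X \<Longrightarrow> y \<in> X \<Longrightarrow> x + y \<in> X"
  using subspace by (rule seq.subspace_add)

lemma diff_mem: "x \<in> X \<Longrightarrow> y \<in> X \<Longrightarrow> x - y \<in> X"
  using subspace by (rule seq.subspace_diff)

lemma scale_mem: "x \<in> X \<Longrightarrow> seq_scale c x \<in> X"
  using subspace by (rule seq.subspace_scale)

lemma nrm_zero: "nrm 0 = 0"
  using nrm_eq_0_iff zero_mem by blast

lemma nrm_diff_commute: "x \<in> X \<Longrightarrow> y \<in> X \<Longrightarrow> nrm (x - y) = nrm (y - x)"
  using metric.commute[of x y] by (simp add: norm_dist_def)

lemma nrm_diff_triangle: "x \<in> X \<Longrightarrow> y \<in> X \<Longrightarrow> nrm (x - y) \<le> nrm x + nrm y"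
  using nrm_triangle[of x "0 - y"] nrm_diff_commute[of 0 y] diff_mem[OF zero_mem, of y] zero_mem
  by simp

lemma nrm_le_add_diff: "x \<in> X \<Longrightarrow> y \<in> X \<Longrightarrow> nrm x \<le> nrm y + nrm (x - y)"
  using nrm_triangle[of y "x - y"] diff_mem by simp

text \<open>Continuity at \<open>0\<close> yields boundedness by rescaling every vector to a small one.\<close>

lemma continuous_linear_bounded:
  assumes cont: "continuous_map (norm_topology X nrm) (norm_topology X nrm) F"
    and scale: "\<And>c x. x \<in> X \<Longrightarrow> F (seq_scale c x) = seq_scale c (F x)"
  obtains D where "0 < D" and "\<And>x. x \<in> X \<Longrightarrow> nrm (F x) \<le> D * nrm x"
proof -
  have F_mem: "F x \<in> X" if "x \<in> X" for x
    using cont that unfolding metric.metric_continuous_map[OF metric.Metric_space_axioms] by blast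
  have F0: "F 0 = 0"
    using scale[OF zero_mem, of 0] by (simp only: seq.scale_zero_left)
  obtain \<delta> where \<delta>: "0 < \<delta>"
    and small: "\<And>x. x \<in> X \<Longrightarrow> norm_dist X nrm 0 x < \<delta> \<Longrightarrow> norm_dist X nrm (F 0) (F x) < 1"
    using cont zero_mem unfolding metric.metric_continuous_map[OF metric.Metric_space_axioms]
    by (metis zero_less_one)
  have small': "nrm (F x) < 1" if "x \<in> X" "nrm x < \<delta>" for x
    using small[OF that(1)] that F_mem zero_mem F0 nrm_diff_commute[OF zero_mem]
    by (simp add: norm_dist_def)
  have "nrm (F x) \<le> 2 / \<delta> * nrm x" if x: "x \<in> X" for x
  proof (cases "x = 0")
    case True
    then show ?thesis by (simp add: F0 nrm_zero)
  next
    case False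
    then have nx: "0 < nrm x"
      using nrm_nonneg[OF x] nrm_eq_0_iff[OF x] by linarith
    define c where "c = \<delta> / (2 * nrm x)"
    have c: "0 < c" using nx \<delta> by (simp add: c_def)
    have "nrm (seq_scale (of_real c) x) = \<delta> / 2"
      unfolding nrm_scale[OF x] using nx c by (simp add: c_def[symmetric]) (simp add: c_def)
    then have "nrm (F (seq_scale (of_real c) x)) < 1"
      using small'[OF scale_mem[OF x]] \<delta> by simp
    then have "c * nrm (F x) < 1"
      using c by (simp add: scale[OF x] nrm_scale[OF F_mem[OF x]])
    then show ?thesis
      using nx \<delta> by (simp add: c_def field_simps)
  qed
  then show ?thesis
    using that[of "2 / \<delta>"] \<delta> by simp
qed

end

context banach_sequence_space
begin

interpretation metric: Metric_space X "norm_dist X nrm"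
  by (rule Metric_space_norm_dist)

lemma tendsto_coordinate:
  assumes "limitin (norm_topology X nrm) \<sigma> l sequentially"
  shows "(\<lambda>n. \<sigma> n m) \<longlonglongrightarrow> l m"
  using continuous_map_limit[OF continuous_inclusion assms]
  by (simp add: limitin_componentwise o_def)

text \<open>A geometrically dominated series converges in norm. Its sum is identified through the
  coordinates, so that linear identities between such sums become identities between series
  of scalars.\<close>

lemma geometric_series_sum:
  assumes z: "\<And>n. z n \<in> X" "\<And>n. nrm (z n) \<le> C * t ^ n" and t: "0 \<le> t" "t < 1" and C: "0 \<le> C"
  obtains s where "s \<in> X" and "nrm s \<le> C / (1 - t)" and "\<And>m. (\<lambda>n. z n m) sums s m"
proof -
  define \<sigma> where "\<sigma> n = (\<lambda>m. \<Sum>i<n. z i m)" for n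
  have \<sigma>_0: "\<sigma> 0 = 0" by (simp add: \<sigma>_def fun_eq_iff)
  have \<sigma>_Suc: "\<sigma> (Suc n) = \<sigma> n + z n" for n
    by (simp add: \<sigma>_def fun_eq_iff)
  have \<sigma>_mem: "\<sigma> n \<in> X" for n
    by (induction n) (simp_all only: \<sigma>_0 \<sigma>_Suc zero_mem add_mem z)
  have "nrm (\<sigma> n - \<sigma> m) \<le> C * (t ^ m - t ^ n) / (1 - t)" if "m \<le> n" for m n
    using that
  proof (induction n rule: dec_induct)
    case base
    show ?case by (simp only: diff_self nrm_zero)
  next
    case (step n)
    have "nrm (\<sigma> (Suc n) - \<sigma> m) \<le> nrm (\<sigma> n - \<sigma> m) + nrm (z n)"
      using nrm_triangle[of "\<sigma> n - \<sigma> m" "z n"] \<sigma>_mem z(1) diff_mem by (simp add: \<sigma>_Suc algebra_simps)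
    also have "\<dots> \<le> C * (t ^ m - t ^ n) / (1 - t) + C * t ^ n"
      using step z(2) by (intro add_mono)
    also have "\<dots> = C * (t ^ m - t ^ Suc n) / (1 - t)"
      using t by (simp add: field_simps)
    finally show ?case .
  qed
  moreover have "C * (t ^ m - t ^ n) / (1 - t) \<le> C / (1 - t) * t ^ m" for m n
    using t C by (simp add: divide_right_mono mult_left_mono)
  ultimately have tail: "nrm (\<sigma> n - \<sigma> m) \<le> C / (1 - t) * t ^ m" if "m \<le> n" for m n
    using that by (meson order_trans)
  have "(\<lambda>n. C / (1 - t) * t ^ n) \<longlonglongrightarrow> C / (1 - t) * 0"
    using t by (intro tendsto_intros LIMSEQ_power_zero) auto
  then have tail_small: "\<forall>\<^sub>F n in sequentially. C / (1 - t) * t ^ n < \<epsilon>" if "\<epsilon> > 0" for \<epsilon>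
    using that by (intro order_tendstoD) auto
  have "metric.MCauchy \<sigma>"
    unfolding metric.MCauchy_def
  proof (intro conjI allI impI)
    show "range \<sigma> \<subseteq> X" using \<sigma>_mem by blast
    fix \<epsilon> :: real assume "\<epsilon> > 0"
    then obtain N where N: "\<And>n. n \<ge> N \<Longrightarrow> C / (1 - t) * t ^ n < \<epsilon>"
      using tail_small by (auto simp: eventually_sequentially)
    have less: "nrm (\<sigma> n - \<sigma> m) < \<epsilon>" if "N \<le> m" "m \<le> n" for m n
      using tail[OF that(2)] N[OF that(1)] by linarith
    show "\<exists>N. \<forall>n n'. N \<le> n \<longrightarrow> N \<le> n' \<longrightarrow> norm_dist X nrm (\<sigma> n) (\<sigma> n') < \<epsilon>"
    proof (intro exI[of _ N] allI impI)
      fix n n' assume "N \<le> n" "N \<le> n'"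
      then show "norm_dist X nrm (\<sigma> n) (\<sigma> n') < \<epsilon>"
        using less[of n' n] less[of n n'] nrm_diff_commute[of "\<sigma> n" "\<sigma> n'"] \<sigma>_mem
        by (cases "n' \<le> n") (auto simp: norm_dist_def)
    qed
  qed
  then obtain s where s: "limitin (norm_topology X nrm) \<sigma> s sequentially"
    using complete unfolding metric.mcomplete_def by blast
  have s_mem: "s \<in> X"
    using metric.limitin_mspace[OF s] .
  have "nrm s \<le> C / (1 - t) + \<epsilon>" if \<epsilon>: "\<epsilon> > 0" for \<epsilon>
  proof -
    obtain n where "norm_dist X nrm (\<sigma> n) s < \<epsilon>"
      using s \<epsilon> unfolding metric.limit_metric_sequentially by blast
    then have "nrm (s - \<sigma> n) < \<epsilon>"
      using nrm_diff_commute[OF s_mem \<sigma>_mem] s_mem \<sigma>_mem by (simp add: norm_dist_def)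
    moreover have "nrm (\<sigma> n) \<le> C / (1 - t)"
      using tail[of 0 n] by (simp add: \<sigma>_0)
    ultimately show ?thesis
      using nrm_le_add_diff[OF s_mem \<sigma>_mem[of n]] by linarith
  qed
  then have "nrm s \<le> C / (1 - t)" by (rule field_le_epsilon)
  moreover have "(\<lambda>n. z n m) sums s m" for m
    unfolding sums_def using tendsto_coordinate[OF s] by (simp add: \<sigma>_def)
  ultimately show ?thesis using s_mem that by blast
qed

end

section \<open>Two-sided products of weights\<close>

definition two_sided_prod :: "(int \<Rightarrow> 'k::field) \<Rightarrow> int \<Rightarrow> 'k" where
  "two_sided_prod w k = (if 0 \<le> k then \<Prod>j\<in>{0..<k}. w j else inverse (\<Prod>j\<in>{k..<0}. w j))"

definition two_sided_sum :: "(int \<Rightarrow> real) \<Rightarrow> int \<Rightarrow> real" where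
  "two_sided_sum b k = (if 0 \<le> k then \<Sum>j\<in>{0..<k}. b j else - (\<Sum>j\<in>{k..<0}. b j))"

lemma two_sided_prod_0 [simp]: "two_sided_prod w 0 = 1"
  by (simp add: two_sided_prod_def)

lemma two_sided_prod_step:
  assumes "w k \<noteq> 0"
  shows "two_sided_prod w (k + 1) = w k * two_sided_prod w k"
proof (cases "0 \<le> k")
  case True
  then have "{0..<k + 1} = insert k {0..<k}" by auto
  with True show ?thesis by (simp add: two_sided_prod_def)
next
  case False
  then have "{k..<0} = insert k {k + 1..<0}" by auto
  with False assms show ?thesis by (auto simp: two_sided_prod_def)
qed

lemma two_sided_sum_step: "two_sided_sum b (k + 1) = two_sided_sum b k + b k"
proof (cases "0 \<le> k")
  case True
  then have "{0..<k + 1} = insert k {0..<k}" by auto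
  with True show ?thesis by (simp add: two_sided_sum_def)
next
  case False
  then have "{k..<0} = insert k {k + 1..<0}" by auto
  with False show ?thesis by (auto simp: two_sided_sum_def)
qed

lemma two_sided_prod_nonzero:
  fixes w :: "int \<Rightarrow> 'k::field"
  assumes "\<And>k. w k \<noteq> 0"
  shows "two_sided_prod w k \<noteq> 0"
  using assms by (simp add: two_sided_prod_def)

lemma prod_eq_two_sided_prod_quotient:
  fixes w :: "int \<Rightarrow> 'k::field"
  assumes "\<And>k. w k \<noteq> 0"
  shows "(\<Prod>j\<in>{k..k + int n - 1}. w j) = two_sided_prod w (k + int n) / two_sided_prod w k"
proof (induction n)
  case 0
  show ?case using two_sided_prod_nonzero[OF assms] by simp
next
  case (Suc n)
  have "{k..k + int (Suc n) - 1} = insert (k + int n) {k..k + int n - 1}" by auto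
  moreover have "two_sided_prod w (k + int (Suc n)) = w (k + int n) * two_sided_prod w (k + int n)"
    using two_sided_prod_step[of w "k + int n", OF assms] by (simp add: add.assoc add.commute[of 1])
  ultimately show ?case using Suc by simp
qed

section \<open>Iterates of the weighted shift\<close>

locale nonzero_weighted_shift = admissible_sequence_space w X nrm
  for w :: "int \<Rightarrow> 'k::real_normed_field" and X nrm +
  assumes weight_nonzero: "w n \<noteq> 0"
begin

interpretation metric: Metric_space X "norm_dist X nrm"
  by (rule Metric_space_norm_dist)

abbreviation W :: "int \<Rightarrow> 'k" where "W \<equiv> two_sided_prod w"

lemma W_nonzero: "W k \<noteq> 0"
  using weight_nonzero by (rule two_sided_prod_nonzero)

lemma W_step: "W (k + 1) = w k * W k"
  using weight_nonzero by (rule two_sided_prod_step)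

text \<open>The \<open>j\<close>-th iterate of the shift, for every integer \<open>j\<close>. It has a closed form because the
  shift is conjugate, by the diagonal map with entries \<open>W m\<close>, to the unweighted shift.\<close>

definition shift_iterate :: "int \<Rightarrow> (int \<Rightarrow> 'k) \<Rightarrow> int \<Rightarrow> 'k" where
  "shift_iterate j x = (\<lambda>m. W (m + j) / W m * x (m + j))"

lemma shift_iterate_0: "shift_iterate 0 x = x"
  using W_nonzero by (simp add: shift_iterate_def)

lemma shift_iterate_1: "shift_iterate 1 x = weighted_shift w x"
  using W_nonzero by (simp add: shift_iterate_def weighted_shift_def W_step)

lemma shift_iterate_add: "shift_iterate i (shift_iterate j x) = shift_iterate (i + j) x"
  using W_nonzero by (simp add: shift_iterate_def fun_eq_iff add.assoc)

lemma shift_iterate_minus: "shift_iterate j (x - y) = shift_iterate j x - shift_iterate j y"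
  by (simp add: shift_iterate_def fun_eq_iff right_diff_distrib)

lemma shift_iterate_scale: "shift_iterate j (seq_scale c x) = seq_scale c (shift_iterate j x)"
  by (simp add: shift_iterate_def seq_scale_def fun_eq_iff)

lemma homeomorphic_shift:
  "homeomorphic_map (norm_topology X nrm) (norm_topology X nrm) (weighted_shift w)"
  using invertible by (simp add: invertible_operator_def)

lemma shift_image: "weighted_shift w ` X = X"
  using homeomorphic_imp_surjective_map[OF homeomorphic_shift] by simp

lemma inv_shift:
  assumes "y \<in> X"
  shows "inv_into X (weighted_shift w) y = shift_iterate (- 1) y" and "shift_iterate (- 1) y \<in> X"
proof -
  let ?x = "inv_into X (weighted_shift w) y"
  have "y \<in> weighted_shift w ` X" using assms shift_image by simp
  then have "?x \<in> X" "weighted_shift w ?x = y"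
    by (rule inv_into_into, rule f_inv_into_f)
  moreover have "shift_iterate (- 1) (weighted_shift w ?x) = ?x"
    by (simp add: shift_iterate_1[symmetric] shift_iterate_add shift_iterate_0)
  ultimately show "?x = shift_iterate (- 1) y" "shift_iterate (- 1) y \<in> X" by simp_all
qed

lemma shift_power: "x \<in> X \<Longrightarrow> (weighted_shift w ^^ n) x = shift_iterate (int n) x \<and> shift_iterate (int n) x \<in> X"
proof (induction n)
  case (Suc n)
  have "shift_iterate (int (Suc n)) x = weighted_shift w (shift_iterate (int n) x)"
    by (simp add: shift_iterate_1[symmetric] shift_iterate_add)
  then show ?case using Suc shift_image by auto
qed (simp add: shift_iterate_0)

lemma inv_shift_power:
  "x \<in> X \<Longrightarrow> (inv_into X (weighted_shift w) ^^ n) x = shift_iterate (- int n) x \<and> shift_iterate (- int n) x \<in> X"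
proof (induction n)
  case (Suc n)
  have "shift_iterate (- int (Suc n)) x = shift_iterate (- 1) (shift_iterate (- int n) x)"
    by (simp add: shift_iterate_add)
  then show ?case using Suc inv_shift by auto
qed (simp add: shift_iterate_0)

lemma shift_iterate_mem: "x \<in> X \<Longrightarrow> shift_iterate j x \<in> X"
  using shift_power[of x "nat j"] inv_shift_power[of x "nat (- j)"] by (cases "0 \<le> j") auto

lemma int_iterate_shift: "x \<in> X \<Longrightarrow> int_iterate X (weighted_shift w) j x = shift_iterate j x"
  using shift_power[of x "nat j"] inv_shift_power[of x "nat (- j)"] by (auto simp: int_iterate_def)

lemma shift_iterate_unit:
  "shift_iterate j (unit_seq k) = seq_scale (W k / W (k - j)) (unit_seq (k - j))"
  by (auto simp: shift_iterate_def unit_seq_def seq_scale_def fun_eq_iff)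

text \<open>Since the shift is invertible, one unit vector brings all the others into the space.\<close>

lemma unit_vector_mem: "unit_seq k \<in> X"
proof -
  have "seq_scale (W k) (shift_iterate (- k) (unit_seq 0)) = unit_seq k"
    using W_nonzero by (simp add: shift_iterate_unit seq_scale_def fun_eq_iff)
  moreover have "shift_iterate (- k) (unit_seq 0) \<in> X"
    using shift_iterate_mem unit_seq_mem[of 0] by simp
  ultimately show ?thesis using scale_mem by metis
qed

lemma shift_iterate_bounded:
  assumes "j = 1 \<or> j = - 1"
  obtains D where "0 < D" and "\<And>x. x \<in> X \<Longrightarrow> nrm (shift_iterate j x) \<le> D * nrm x"
proof -
  obtain g where g: "homeomorphic_maps (norm_topology X nrm) (norm_topology X nrm) (weighted_shift w) g"
    using homeomorphic_shift unfolding homeomorphic_map_maps by blast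
  have "g x = shift_iterate (- 1) x" if "x \<in> X" for x
  proof -
    have "weighted_shift w (g x) = x" using g that by (simp add: homeomorphic_maps_def)
    then have "shift_iterate (- 1) (shift_iterate 1 (g x)) = shift_iterate (- 1) x"
      by (simp add: shift_iterate_1)
    then show ?thesis by (simp add: shift_iterate_add shift_iterate_0)
  qed
  then have "continuous_map (norm_topology X nrm) (norm_topology X nrm) (shift_iterate (- 1))"
    using g by (auto simp: homeomorphic_maps_def intro: continuous_map_eq)
  moreover have "continuous_map (norm_topology X nrm) (norm_topology X nrm) (shift_iterate 1)"
    using homeomorphic_imp_continuous_map[OF homeomorphic_shift]
    by (rule continuous_map_eq) (simp add: shift_iterate_1)
  ultimately show ?thesis
    using that continuous_linear_bounded[of "shift_iterate j"] assms shift_iterate_scale by metis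
qed

text \<open>The reciprocal norm of the vector \<open>unit_seq k / W k\<close>. The shift maps these vectors to each
  other, so the quotients of the values of \<open>scaled_weight\<close> are the products of the normalised weights.\<close>

definition scaled_weight :: "int \<Rightarrow> real" where
  "scaled_weight k = norm (W k) / nrm (unit_seq k)"

lemma nrm_unit_pos: "0 < nrm (unit_seq k)"
proof -
  have "unit_seq k \<noteq> (0 :: int \<Rightarrow> 'k)"
    by (auto simp: unit_seq_def fun_eq_iff)
  then show ?thesis
    using nrm_nonneg[OF unit_vector_mem] nrm_eq_0_iff[OF unit_vector_mem] by (metis order_le_less)
qed

lemma scaled_weight_pos: "0 < scaled_weight k"
  using nrm_unit_pos W_nonzero by (simp add: scaled_weight_def)

lemma nrm_shift_iterate_unit:
  "nrm (shift_iterate j (unit_seq k)) = scaled_weight k / scaled_weight (k - j) * nrm (unit_seq k)"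
  using nrm_unit_pos[of k] nrm_unit_pos[of "k - j"] W_nonzero
  by (simp add: shift_iterate_unit nrm_scale[OF unit_vector_mem] scaled_weight_def norm_divide)

lemma scaled_weight_ratio_bounded:
  obtains D where "\<And>k. scaled_weight (k + 1) \<le> D * scaled_weight k" and "\<And>k. scaled_weight k \<le> D * scaled_weight (k + 1)"
proof -
  obtain D1 where D1: "0 < D1" "\<And>x. x \<in> X \<Longrightarrow> nrm (shift_iterate 1 x) \<le> D1 * nrm x"
    using shift_iterate_bounded by blast
  obtain D2 where D2: "0 < D2" "\<And>x. x \<in> X \<Longrightarrow> nrm (shift_iterate (- 1) x) \<le> D2 * nrm x"
    using shift_iterate_bounded by blast
  have "scaled_weight k \<le> D * scaled_weight (k - j)"
    if "\<And>x. x \<in> X \<Longrightarrow> nrm (shift_iterate j x) \<le> D * nrm x" for D k j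
    using that[OF unit_vector_mem, of k] nrm_unit_pos[of k] scaled_weight_pos[of "k - j"]
    by (simp add: nrm_shift_iterate_unit field_simps)
  from this[OF D1(2)] this[OF D2(2)]
  have le: "scaled_weight k \<le> D1 * scaled_weight (k - 1)" "scaled_weight k \<le> D2 * scaled_weight (k + 1)" for k
    by fastforce+
  show ?thesis
  proof (rule that[of "max D1 D2"])
    fix k
    show "scaled_weight (k + 1) \<le> max D1 D2 * scaled_weight k"
      using le(1)[of "k + 1"] mult_right_mono[OF max.cobounded1[of D1 D2] less_imp_le[OF scaled_weight_pos[of k]]] by simp
    show "scaled_weight k \<le> max D1 D2 * scaled_weight (k + 1)"
      using le(2)[of k] mult_right_mono[OF max.cobounded2[of D2 D1] less_imp_le[OF scaled_weight_pos[of "k + 1"]]] by linarith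
  qed
qed

lemma weight_product_scaled_weight:
  "norm (\<Prod>j\<in>{k..k + int n - 1}. w j) * (nrm (unit_seq k) / nrm (unit_seq (k + int n))) =
    scaled_weight (k + int n) / scaled_weight k"
  unfolding prod_eq_two_sided_prod_quotient[OF weight_nonzero]
  by (simp add: scaled_weight_def norm_divide)

section \<open>Shadowing forces a growth condition\<close>

text \<open>One pseudotrajectory suffices. It moves along the vectors \<open>unit_seq (- j) / W (- j)\<close>, which
  the shift maps to each other, and the jump at each time is \<open>\<delta>\<close> times the next vector, normalised.
  The coefficients of this pseudotrajectory are, up to the sign, the partial sums \<open>T\<close> of \<open>\<delta> * scaled_weight\<close>. Every true
  trajectory has a constant coefficient along these vectors, so shadowing keeps \<open>T k\<close> within
  \<open>scaled_weight k\<close> of a constant.\<close>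

lemma growth_if_shadowing:
  assumes "shadowing_property X (norm_dist X nrm) (weighted_shift w)"
  shows "uniform_growth (\<lambda>k. scaled_weight (- k)) UNIV \<or> uniform_growth scaled_weight UNIV \<or>
    uniform_growth (\<lambda>k. scaled_weight (- k)) {1..} \<and> uniform_growth scaled_weight {1..}"
proof -
  obtain \<delta>' where \<delta>': "0 < \<delta>'"
    and shadow: "\<And>x :: int \<Rightarrow> int \<Rightarrow> 'k. (\<forall>j. x j \<in> X) \<Longrightarrow>
      (\<forall>j. norm_dist X nrm (weighted_shift w (x j)) (x (j + 1)) \<le> \<delta>') \<Longrightarrow>
      \<exists>y\<in>X. \<forall>j. norm_dist X nrm (x j) (int_iterate X (weighted_shift w) j y) < 1"
    using assms unfolding shadowing_property_def by (metis zero_less_one)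
  define \<delta> where "\<delta> = min \<delta>' (1 / 2)"
  have \<delta>: "0 < \<delta>" "\<delta> < 1" "\<delta> \<le> \<delta>'" using \<delta>' by (auto simp: \<delta>_def)
  define T where "T = two_sided_sum (\<lambda>k. \<delta> * scaled_weight k)"
  have T_step: "T (k + 1) = T k + \<delta> * scaled_weight k" for k
    by (simp add: T_def two_sided_sum_step)
  define x :: "int \<Rightarrow> int \<Rightarrow> 'k"
    where "x j = seq_scale (- of_real (T (- j)) / W (- j)) (unit_seq (- j))" for j
  have x_mem: "x j \<in> X" for j
    unfolding x_def by (intro scale_mem unit_vector_mem)
  have shift_x: "weighted_shift w (x j) =
      seq_scale (- of_real (T (- j)) / W (- j - 1)) (unit_seq (- j - 1))" for j
    unfolding x_def shift_iterate_1[symmetric] shift_iterate_scale shift_iterate_unit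
    using W_nonzero by (simp add: seq_scale_def fun_eq_iff)
  have "norm_dist X nrm (weighted_shift w (x j)) (x (j + 1)) \<le> \<delta>'" for j
  proof -
    let ?k = "- j - 1"
    have "T (- j) = T ?k + \<delta> * scaled_weight ?k"
      using T_step[of ?k] by simp
    moreover have "- (j + 1) = ?k" by simp
    ultimately have "weighted_shift w (x j) - x (j + 1) =
        seq_scale (- of_real (\<delta> * scaled_weight ?k) / W ?k) (unit_seq ?k)"
      unfolding shift_x unfolding x_def
      by (simp only: seq_scale_def fun_eq_iff minus_apply of_real_add minus_add_distrib
          left_diff_distrib[symmetric] diff_divide_distrib[symmetric]) simp
    then have "nrm (weighted_shift w (x j) - x (j + 1)) = \<delta>"
      using nrm_scale[OF unit_vector_mem, of "- of_real (\<delta> * scaled_weight ?k) / W ?k" ?k] \<delta>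
        scaled_weight_pos[of ?k] nrm_unit_pos[of ?k] W_nonzero[of ?k]
      by (simp add: norm_divide norm_mult scaled_weight_def)
    moreover have "weighted_shift w (x j) \<in> X"
      using x_mem shift_image by blast
    ultimately show ?thesis
      using x_mem \<delta> by (simp add: norm_dist_def)
  qed
  then obtain y where y: "y \<in> X"
    and near: "\<And>j. norm_dist X nrm (x j) (int_iterate X (weighted_shift w) j y) < 1"
    using shadow x_mem by blast
  have "norm (of_real (T k) + y 0) \<le> scaled_weight k" for k
  proof -
    let ?d = "x (- k) - shift_iterate (- k) y"
    have "nrm ?d < 1"
      using near[of "- k"] y x_mem shift_iterate_mem by (simp add: int_iterate_shift norm_dist_def)
    moreover have "norm (?d k) * nrm (unit_seq k) \<le> nrm ?d"
      using y by (intro C1 diff_mem x_mem shift_iterate_mem)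
    ultimately have "norm (?d k) * nrm (unit_seq k) \<le> 1" by linarith
    have d: "?d k = - (of_real (T k) + y 0) / W k"
      by (simp add: x_def seq_scale_def unit_seq_def shift_iterate_def add_divide_distrib diff_divide_distrib)
    have eq: "norm (?d k) = norm (of_real (T k) + y 0) / norm (W k)"
      unfolding d by (simp only: norm_divide norm_minus_cancel)
    with \<open>norm (?d k) * nrm (unit_seq k) \<le> 1\<close> show ?thesis
      using nrm_unit_pos[of k] W_nonzero[of k] unfolding eq by (simp add: scaled_weight_def field_simps)
  qed
  then show ?thesis
    using growth_trichotomy[of scaled_weight \<delta> T "y 0"] scaled_weight_pos \<delta> T_step by blast
qed

section \<open>A growth condition forces shadowing\<close>

text \<open>If positive iterates contract the part \<open>P x\<close> of every vector and negative iterates contract the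
  rest, then the equation \<open>s (j + 1) = shift_iterate 1 (s j) + z j\<close> has a small solution \<open>s\<close> for small
  \<open>z\<close>: it transports the parts \<open>P (z i)\<close> of the past forward and the complementary parts of the future
  backward. For the jumps \<open>z\<close> of a pseudotrajectory \<open>x\<close>, the difference \<open>x - s\<close> is a true
  trajectory.\<close>

lemma shadowing_if_splitting:
  assumes C: "0 < C" and t: "0 < t" "t < 1"
    and P_mem: "\<And>x. x \<in> X \<Longrightarrow> P x \<in> X"
    and forward: "\<And>x n. x \<in> X \<Longrightarrow> nrm (shift_iterate (int n) (P x)) \<le> C * t ^ n * nrm x"
    and backward: "\<And>x n. x \<in> X \<Longrightarrow> nrm (shift_iterate (- int n) (x - P x)) \<le> C * t ^ n * nrm x"
  shows "shadowing_property X (norm_dist X nrm) (weighted_shift w)"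
  unfolding shadowing_property_def
proof (intro allI impI)
  fix \<epsilon> :: real assume \<epsilon>: "0 < \<epsilon>"
  define \<delta> where "\<delta> = \<epsilon> * (1 - t) / (4 * C)"
  have \<delta>: "0 < \<delta>" using \<epsilon> t C by (simp add: \<delta>_def)
  have \<delta>_bound: "C * \<delta> / (1 - t) + C * \<delta> / (1 - t) < \<epsilon>"
  proof -
    have "C * \<delta> / (1 - t) = \<epsilon> / 4" using t C by (simp add: \<delta>_def divide_simps)
    then show ?thesis using \<epsilon> by simp
  qed
  show "\<exists>\<delta>>0. \<forall>x. (\<forall>j. x j \<in> X) \<and> (\<forall>j. norm_dist X nrm (weighted_shift w (x j)) (x (j + 1)) \<le> \<delta>) \<longrightarrow>
      (\<exists>y\<in>X. \<forall>j. norm_dist X nrm (x j) (int_iterate X (weighted_shift w) j y) < \<epsilon>)"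
  proof (intro exI[of _ \<delta>] conjI \<delta> allI impI, elim conjE)
    fix x :: "int \<Rightarrow> int \<Rightarrow> 'k"
    assume x_mem': "\<forall>j. x j \<in> X"
      and pseudo: "\<forall>j. norm_dist X nrm (weighted_shift w (x j)) (x (j + 1)) \<le> \<delta>"
    have x_mem: "x j \<in> X" for j using x_mem' by blast
    define z where "z j = x (j + 1) - shift_iterate 1 (x j)" for j
    have z_mem: "z j \<in> X" for j
      unfolding z_def by (intro diff_mem x_mem shift_iterate_mem)
    have z_small: "nrm (z j) \<le> \<delta>" for j
      using pseudo[rule_format, of j] x_mem shift_iterate_mem[OF x_mem, of 1 j]
        nrm_diff_commute[of "x (j + 1)" "shift_iterate 1 (x j)"]
      by (simp add: z_def norm_dist_def shift_iterate_1)
    define past where "past j n = shift_iterate (int n) (P (z (j - 1 - int n)))" for j n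
    \<comment> \<open>The index is shifted by one against \<open>past\<close>: the jump at time \<open>j\<close> enters \<open>s (j + 1)\<close>, so its
      first part is not moved yet, while its second part is moved back by one step already in \<open>s j\<close>.\<close>
    define future where "future j n = shift_iterate (- int (Suc n)) (z (j + int n) - P (z (j + int n)))" for j n
    have past_mem: "past j n \<in> X" and future_mem: "future j n \<in> X" for j n
      unfolding past_def future_def by (intro shift_iterate_mem diff_mem P_mem z_mem)+
    have "nrm (past j n) \<le> (C * \<delta>) * t ^ n" for j n
    proof -
      have "nrm (past j n) \<le> C * t ^ n * nrm (z (j - 1 - int n))"
        unfolding past_def by (rule forward[OF z_mem])
      also have "\<dots> \<le> C * t ^ n * \<delta>"
        using C t by (intro mult_left_mono z_small) auto
      finally show ?thesis by (simp add: ac_simps)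
    qed
    then have "\<exists>s. s \<in> X \<and> nrm s \<le> C * \<delta> / (1 - t) \<and> (\<forall>m. (\<lambda>n. past j n m) sums s m)" for j
      using geometric_series_sum[of "past j" "C * \<delta>" t] past_mem t C \<delta> by (metis less_imp_le mult_nonneg_nonneg)
    then obtain p where p: "p j \<in> X" "nrm (p j) \<le> C * \<delta> / (1 - t)" "(\<lambda>n. past j n m) sums p j m" for j m
      by metis
    have "nrm (future j n) \<le> (C * \<delta>) * t ^ n" for j n
    proof -
      have "nrm (future j n) \<le> C * t ^ Suc n * nrm (z (j + int n))"
        unfolding future_def by (rule backward[OF z_mem])
      also have "\<dots> \<le> C * t ^ n * \<delta>"
        using C t by (intro mult_mono z_small mult_left_mono power_decreasing nrm_nonneg z_mem) auto
      finally show ?thesis by (simp add: ac_simps)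
    qed
    then have "\<exists>s. s \<in> X \<and> nrm s \<le> C * \<delta> / (1 - t) \<and> (\<forall>m. (\<lambda>n. future j n m) sums s m)" for j
      using geometric_series_sum[of "future j" "C * \<delta>" t] future_mem t C \<delta> by (metis less_imp_le mult_nonneg_nonneg)
    then obtain f where f: "f j \<in> X" "nrm (f j) \<le> C * \<delta> / (1 - t)" "(\<lambda>n. future j n m) sums f j m" for j m
      by metis
    have p_step: "p (j + 1) m = w m * p j (m + 1) + P (z j) m" for j m
    proof -
      have "past (j + 1) (Suc n) = shift_iterate 1 (past j n)" for n
        by (simp add: past_def shift_iterate_add algebra_simps)
      then have "past (j + 1) (Suc n) m = w m * past j n (m + 1)" for n
        by (simp add: shift_iterate_1 weighted_shift_def)
      then have "(\<lambda>n. past (j + 1) (Suc n) m) sums (w m * p j (m + 1))"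
        using sums_mult[OF p(3)] by simp
      then have "(\<lambda>n. past (j + 1) n m) sums (w m * p j (m + 1) + past (j + 1) 0 m)"
        by (rule sums_Suc)
      moreover have "past (j + 1) 0 m = P (z j) m"
        by (simp add: past_def shift_iterate_0)
      ultimately show ?thesis
        using p(3)[of "j + 1" m] by (metis sums_unique2)
    qed
    have f_step: "w m * f j (m + 1) = f (j + 1) m + (z j - P (z j)) m" for j m
    proof -
      have "shift_iterate 1 (future j (Suc n)) = future (j + 1) n" for n
        by (simp add: future_def shift_iterate_add algebra_simps)
      then have "w m * future j (Suc n) (m + 1) = future (j + 1) n m" for n
        by (metis shift_iterate_1 weighted_shift_def)
      then have "(\<lambda>n. w m * future j (Suc n) (m + 1)) sums f (j + 1) m"
        using f(3)[of "j + 1" m] by simp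
      then have "(\<lambda>n. w m * future j n (m + 1)) sums (f (j + 1) m + w m * future j 0 (m + 1))"
        by (rule sums_Suc)
      moreover have "shift_iterate 1 (future j 0) = z j - P (z j)"
        by (simp add: future_def shift_iterate_add shift_iterate_0)
      then have "w m * future j 0 (m + 1) = (z j - P (z j)) m"
        by (metis shift_iterate_1 weighted_shift_def)
      ultimately show ?thesis
        using sums_mult[OF f(3)[of j "m + 1"], of "w m"] by (metis sums_unique2)
    qed
    define s where "s j = p j - f j" for j
    have s_mem: "s j \<in> X" for j unfolding s_def by (intro diff_mem p f)
    have s_small: "nrm (s j) < \<epsilon>" for j
      using nrm_diff_triangle[OF p(1) f(1), of j j] p(2)[of j] f(2)[of j] \<delta>_bound
      unfolding s_def by linarith
    have s_step: "s (j + 1) = shift_iterate 1 (s j) + z j" for j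
    proof
      fix m
      show "s (j + 1) m = (shift_iterate 1 (s j) + z j) m"
        using p_step[of j m] f_step[of m j]
        by (simp add: s_def shift_iterate_1 weighted_shift_def algebra_simps)
    qed
    define y where "y j = x j - s j" for j
    have y_step: "y (j + 1) = shift_iterate 1 (y j)" for j
      unfolding y_def s_step shift_iterate_minus z_def by (simp add: algebra_simps)
    have y_orbit: "y j = shift_iterate j (y 0)" for j
    proof (induction j rule: int_induct[where k = 0])
      case base
      show ?case by (simp add: shift_iterate_0)
    next
      case (step1 i)
      then show ?case using y_step[of i] by (simp add: shift_iterate_add add.commute)
    next
      case (step2 i)
      have "y (i - 1) = shift_iterate (- 1) (y i)"
        using y_step[of "i - 1"] by (simp add: shift_iterate_add shift_iterate_0)
      also have "\<dots> = shift_iterate (i - 1) (y 0)"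
        by (subst step2(2)) (simp add: shift_iterate_add)
      finally show ?case .
    qed
    have y_mem: "y j \<in> X" for j unfolding y_def by (intro diff_mem x_mem s_mem)
    show "\<exists>y\<in>X. \<forall>j. norm_dist X nrm (x j) (int_iterate X (weighted_shift w) j y) < \<epsilon>"
    proof (intro bexI[of _ "y 0"] allI y_mem)
      fix j
      have "x j - y j = s j" by (simp add: y_def)
      then show "norm_dist X nrm (x j) (int_iterate X (weighted_shift w) j (y 0)) < \<epsilon>"
        using s_small[of j] x_mem y_mem
        by (simp add: int_iterate_shift norm_dist_def y_orbit[symmetric])
    qed
  qed
qed

text \<open>On a vector supported in a set of indices, the iterates are controlled by the growth of
  \<open>scaled_weight\<close> along that set.\<close>

lemma shift_iterate_le:
  assumes x: "x \<in> X" and bound: "\<And>k. x k \<noteq> 0 \<Longrightarrow> scaled_weight k \<le> c * scaled_weight (k - int n)"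
  shows "nrm (shift_iterate (int n) x) \<le> c * nrm x"
proof (cases "n = 0")
  case True
  have "nrm x \<le> c * nrm x"
  proof (cases "x = 0")
    case False
    then obtain k where "x k \<noteq> 0" by (auto simp: fun_eq_iff)
    then have "1 \<le> c" using bound[of k] scaled_weight_pos[of k] True by simp
    then show ?thesis using mult_right_mono[of 1 c "nrm x"] nrm_nonneg[OF x] by simp
  qed (simp add: nrm_zero)
  then show ?thesis using True by (simp add: shift_iterate_0)
next
  case False
  have "(SUP k\<in>{k. x k \<noteq> 0}. ereal (norm (\<Prod>j\<in>{k - int n..k - 1}. w j) *
      (nrm (unit_seq (k - int n)) / nrm (unit_seq k)))) \<le> ereal c"
  proof (rule SUP_least)
    fix k assume "k \<in> {k. x k \<noteq> 0}"
    then have "scaled_weight k / scaled_weight (k - int n) \<le> c"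
      using bound[of k] scaled_weight_pos[of "k - int n"] by (simp add: field_simps)
    then show "ereal (norm (\<Prod>j\<in>{k - int n..k - 1}. w j) * (nrm (unit_seq (k - int n)) / nrm (unit_seq k))) \<le> ereal c"
      using weight_product_scaled_weight[of "k - int n" n] by simp
  qed
  then have "(SUP k\<in>{k. x k \<noteq> 0}. ereal (norm (\<Prod>j\<in>{k - int n..k - 1}. w j) *
      (nrm (unit_seq (k - int n)) / nrm (unit_seq k)))) * ereal (nrm x) \<le> ereal c * ereal (nrm x)"
    using nrm_nonneg[OF x] by (intro ereal_mult_right_mono) auto
  moreover have "ereal (nrm ((weighted_shift w ^^ n) x)) \<le> (SUP k\<in>{k. x k \<noteq> 0}.
      ereal (norm (\<Prod>j\<in>{k - int n..k - 1}. w j) *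
      (nrm (unit_seq (k - int n)) / nrm (unit_seq k)))) * ereal (nrm x)"
    using x False by (intro C2_shift) auto
  ultimately have "ereal (nrm ((weighted_shift w ^^ n) x)) \<le> ereal c * ereal (nrm x)"
    by (rule order_trans[rotated])
  then show ?thesis using shift_power[OF x, of n] by simp
qed

lemma shift_iterate_inverse_le:
  assumes x: "x \<in> X" and bound: "\<And>k. x k \<noteq> 0 \<Longrightarrow> scaled_weight k \<le> c * scaled_weight (k + int n)"
  shows "nrm (shift_iterate (- int n) x) \<le> c * nrm x"
proof (cases "n = 0")
  case True
  then show ?thesis using shift_iterate_le[OF x, of c 0] bound by simp
next
  case False
  have "(SUP k\<in>{k. x k \<noteq> 0}. ereal (1 / norm (\<Prod>j\<in>{k..k + int n - 1}. w j) *
      (nrm (unit_seq (k + int n)) / nrm (unit_seq k)))) \<le> ereal c"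
  proof (rule SUP_least)
    fix k assume "k \<in> {k. x k \<noteq> 0}"
    then have "scaled_weight k / scaled_weight (k + int n) \<le> c"
      using bound[of k] scaled_weight_pos[of "k + int n"] by (simp add: field_simps)
    moreover have "1 / norm (\<Prod>j\<in>{k..k + int n - 1}. w j) *
        (nrm (unit_seq (k + int n)) / nrm (unit_seq k)) = scaled_weight k / scaled_weight (k + int n)"
      unfolding prod_eq_two_sided_prod_quotient[OF weight_nonzero]
      by (simp add: scaled_weight_def norm_divide)
    ultimately show "ereal (1 / norm (\<Prod>j\<in>{k..k + int n - 1}. w j) *
        (nrm (unit_seq (k + int n)) / nrm (unit_seq k))) \<le> ereal c" by simp
  qed
  then have "(SUP k\<in>{k. x k \<noteq> 0}. ereal (1 / norm (\<Prod>j\<in>{k..k + int n - 1}. w j) *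
      (nrm (unit_seq (k + int n)) / nrm (unit_seq k)))) * ereal (nrm x) \<le> ereal c * ereal (nrm x)"
    using nrm_nonneg[OF x] by (intro ereal_mult_right_mono) auto
  moreover have "ereal (nrm ((inv_into X (weighted_shift w) ^^ n) x)) \<le> (SUP k\<in>{k. x k \<noteq> 0}.
      ereal (1 / norm (\<Prod>j\<in>{k..k + int n - 1}. w j) *
      (nrm (unit_seq (k + int n)) / nrm (unit_seq k)))) * ereal (nrm x)"
    using x False by (intro C2_inverse) auto
  ultimately have "ereal (nrm ((inv_into X (weighted_shift w) ^^ n) x)) \<le> ereal c * ereal (nrm x)"
    by (rule order_trans[rotated])
  then show ?thesis using inv_shift_power[OF x, of n] by simp
qed

definition restrict_seq :: "int set \<Rightarrow> (int \<Rightarrow> 'k) \<Rightarrow> int \<Rightarrow> 'k" where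
  "restrict_seq A x = (\<lambda>k. if k \<in> A then x k else 0)"

text \<open>Sequences supported in \<open>A\<close> are contracted by the positive iterates when \<open>scaled_weight\<close> grows
  leftwards from every point of \<open>A\<close>, those supported outside \<open>A\<close> by the negative iterates when it grows
  rightwards. The three conditions are the cases where \<open>A\<close> is everything, empty, and the set
  of the nonpositive integers.\<close>

lemma shadowing_if_growth_on_complementary_sets:
  assumes A: "\<And>x. x \<in> X \<Longrightarrow> restrict_seq A x \<in> X"
    and D: "0 < D" "\<And>x. x \<in> X \<Longrightarrow> nrm (restrict_seq A x) \<le> D * nrm x"
    and left: "uniform_growth (\<lambda>k. scaled_weight (- k)) {k. - k \<in> A}"
    and right: "uniform_growth scaled_weight (- A)"
  shows "shadowing_property X (norm_dist X nrm) (weighted_shift w)"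
proof -
  obtain C1 t1 where C1: "0 < C1" and t1: "0 < t1" "t1 < 1"
    and left': "\<And>k n. - k \<in> A \<Longrightarrow> scaled_weight (- k) \<le> C1 * t1 ^ n * scaled_weight (- (k + int n))"
    using left unfolding uniform_growth_def by blast
  obtain C2 t2 where C2: "0 < C2" and t2: "0 < t2" "t2 < 1"
    and right': "\<And>k n. k \<in> - A \<Longrightarrow> scaled_weight k \<le> C2 * t2 ^ n * scaled_weight (k + int n)"
    using right unfolding uniform_growth_def by blast
  define C where "C = max C1 C2"
  define t where "t = max t1 t2"
  have C: "0 < C" "C1 \<le> C" "C2 \<le> C" using C1 by (auto simp: C_def)
  have t: "0 < t" "t < 1" "t1 \<le> t" "t2 \<le> t" using t1 t2 by (auto simp: t_def)
  have le: "E * s ^ n * a \<le> C * t ^ n * a'"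
    if "0 \<le> E" "E \<le> C" "0 \<le> s" "s \<le> t" "0 \<le> a" "a \<le> a'" for E s a a' n
    using that C t by (intro mult_mono power_mono) auto
  show ?thesis
  proof (rule shadowing_if_splitting[of "C * (1 + D)" t "restrict_seq A"])
    fix x n assume x: "x \<in> X"
    have nx: "0 \<le> nrm x" by (rule nrm_nonneg[OF x])
    have "nrm (shift_iterate (int n) (restrict_seq A x)) \<le> C1 * t1 ^ n * nrm (restrict_seq A x)"
    proof (rule shift_iterate_le[OF A[OF x]])
      fix k assume "restrict_seq A x k \<noteq> 0"
      then show "scaled_weight k \<le> C1 * t1 ^ n * scaled_weight (k - int n)"
        using left'[of "- k" n] by (simp add: restrict_seq_def split: if_splits)
    qed
    also have "\<dots> \<le> C * t ^ n * ((1 + D) * nrm x)"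
      using C1 C t1 t D(2)[OF x] nx by (intro le nrm_nonneg A x) (auto simp: distrib_right)
    finally show "nrm (shift_iterate (int n) (restrict_seq A x)) \<le> C * (1 + D) * t ^ n * nrm x"
      by (simp add: ac_simps)
    have diff: "x - restrict_seq A x \<in> X" using x A by (intro diff_mem)
    have "nrm (shift_iterate (- int n) (x - restrict_seq A x)) \<le> C2 * t2 ^ n * nrm (x - restrict_seq A x)"
    proof (rule shift_iterate_inverse_le[OF diff])
      fix k assume "(x - restrict_seq A x) k \<noteq> 0"
      then show "scaled_weight k \<le> C2 * t2 ^ n * scaled_weight (k + int n)"
        using right'[of k n] by (simp add: restrict_seq_def split: if_splits)
    qed
    also have "\<dots> \<le> C * t ^ n * ((1 + D) * nrm x)"
      using C2 C t2 t D(2)[OF x] nrm_diff_triangle[OF x A[OF x]]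
      by (intro le nrm_nonneg diff) (auto simp: distrib_right)
    finally show "nrm (shift_iterate (- int n) (x - restrict_seq A x)) \<le> C * (1 + D) * t ^ n * nrm x"
      by (simp add: ac_simps)
  qed (use C D t A in auto)
qed

text \<open>The topological direct sum is what makes the restriction to the nonpositive indices bounded:
  it is the first component of the inverse of the addition homeomorphism.\<close>

lemma restrict_nonpos_bounded:
  obtains D where "0 < D" and "\<And>x. x \<in> X \<Longrightarrow> restrict_seq {..0} x \<in> X"
    and "\<And>x. x \<in> X \<Longrightarrow> nrm (restrict_seq {..0} x) \<le> D * nrm x"
proof -
  let ?T = "norm_topology X nrm"
  let ?M = "{x \<in> X. \<forall>n>0. x n = 0}" and ?N = "{x \<in> X. \<forall>n\<le>0. x n = 0}"
  obtain g where g: "homeomorphic_maps (prod_topology (subtopology ?T ?M) (subtopology ?T ?N)) ?T (\<lambda>(x, y). x + y) g"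
    using direct_sum unfolding topological_direct_sum_def homeomorphic_map_maps by blast
  have cont_g: "continuous_map ?T (prod_topology (subtopology ?T ?M) (subtopology ?T ?N)) g"
    using g by (simp add: homeomorphic_maps_def)
  have fst_g: "fst (g x) = restrict_seq {..0} x" if x: "x \<in> X" for x
  proof -
    have sum: "fst (g x) + snd (g x) = x"
      using g x by (simp add: homeomorphic_maps_def case_prod_unfold)
    have "g x \<in> topspace (prod_topology (subtopology ?T ?M) (subtopology ?T ?N))"
      using continuous_map_image_subset_topspace[OF cont_g] x by auto
    then have "fst (g x) \<in> ?M" "snd (g x) \<in> ?N"
      by (auto simp: mem_Times_iff)
    then have "fst (g x) k = restrict_seq {..0} x k" for k
      using fun_cong[OF sum, of k] by (cases "k \<le> 0") (auto simp: restrict_seq_def)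
    then show ?thesis by blast
  qed
  have "continuous_map ?T (subtopology ?T ?M) (fst \<circ> g)"
    using cont_g continuous_map_fst by (rule continuous_map_compose)
  then have "continuous_map ?T ?T (fst \<circ> g)"
    by (rule continuous_map_into_fulltopology)
  then have cont: "continuous_map ?T ?T (restrict_seq {..0})"
    by (rule continuous_map_eq) (simp add: fst_g)
  have mem: "restrict_seq {..0} x \<in> X" if "x \<in> X" for x
    using continuous_map_image_subset_topspace[OF cont] that by auto
  have "restrict_seq {..0} (seq_scale c x) = seq_scale c (restrict_seq {..0} x)" for c x
    by (simp add: restrict_seq_def seq_scale_def fun_eq_iff)
  then show ?thesis
    using continuous_linear_bounded[OF cont] that mem by metis
qed

theorem shadowing_iff_growth:
  "shadowing_property X (norm_dist X nrm) (weighted_shift w) \<longleftrightarrow>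
    uniform_growth (\<lambda>k. scaled_weight (- k)) UNIV \<or> uniform_growth scaled_weight UNIV \<or>
    uniform_growth (\<lambda>k. scaled_weight (- k)) {1..} \<and> uniform_growth scaled_weight {1..}"
proof
  assume "shadowing_property X (norm_dist X nrm) (weighted_shift w)"
  then show "uniform_growth (\<lambda>k. scaled_weight (- k)) UNIV \<or> uniform_growth scaled_weight UNIV \<or>
      uniform_growth (\<lambda>k. scaled_weight (- k)) {1..} \<and> uniform_growth scaled_weight {1..}"
    by (rule growth_if_shadowing)
next
  have empty: "uniform_growth b {}" for b
    unfolding uniform_growth_def by (auto intro!: exI[of _ 1] exI[of _ "1 / 2"])
  assume "uniform_growth (\<lambda>k. scaled_weight (- k)) UNIV \<or> uniform_growth scaled_weight UNIV \<or>
      uniform_growth (\<lambda>k. scaled_weight (- k)) {1..} \<and> uniform_growth scaled_weight {1..}"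
  then consider
      (stable) "uniform_growth (\<lambda>k. scaled_weight (- k)) UNIV"
    | (unstable) "uniform_growth scaled_weight UNIV"
    | (split) "uniform_growth (\<lambda>k. scaled_weight (- k)) {1..}" "uniform_growth scaled_weight {1..}"
    by blast
  then show "shadowing_property X (norm_dist X nrm) (weighted_shift w)"
  proof cases
    case stable
    have "restrict_seq UNIV = (\<lambda>x. x)" by (simp add: restrict_seq_def fun_eq_iff)
    with stable empty show ?thesis
      by (intro shadowing_if_growth_on_complementary_sets[of UNIV 1]) auto
  next
    case unstable
    have "restrict_seq {} = (\<lambda>x. 0)" by (simp add: restrict_seq_def fun_eq_iff)
    moreover have "nrm 0 \<le> 1 * nrm x" if "x \<in> X" for x
      using nrm_zero nrm_nonneg[OF that] by linarith
    ultimately show ?thesis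
      using unstable empty zero_mem
      by (intro shadowing_if_growth_on_complementary_sets[of "{}" 1]) (simp_all only: Compl_empty_eq empty_iff empty_def[symmetric])
  next
    case split
    have "uniform_growth (\<lambda>k. scaled_weight (- k)) {0..}"
      using uniform_growth_move[of "\<lambda>k. scaled_weight (- k)"] scaled_weight_pos split(1) by blast
    moreover have "{k. - k \<in> {..0}} = {0::int..}" "- {..0} = {1::int..}" by auto
    moreover obtain D where "0 < D" and "\<And>x. x \<in> X \<Longrightarrow> restrict_seq {..0} x \<in> X"
      and "\<And>x. x \<in> X \<Longrightarrow> nrm (restrict_seq {..0} x) \<le> D * nrm x"
      using restrict_nonpos_bounded by blast
    ultimately show ?thesis
      using split(2) by (intro shadowing_if_growth_on_complementary_sets[of "{..0}" D]) simp_all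
  qed
qed

section \<open>The root limits of the shift\<close>

text \<open>In the three conditions the \<open>n\<close>-step products of the weights, normalised by the norms of the
  unit vectors, are quotients of the values of \<open>scaled_weight\<close>.\<close>

lemma lim_SUP_all_iff:
  "(\<exists>L<1. (\<lambda>n::nat. SUP k::int. ereal ((norm (\<Prod>j\<in>{k..k + int n - 1}. w j) *
      (nrm (unit_seq k) / nrm (unit_seq (k + int n)))) powr (1 / real n))) \<longlonglongrightarrow> L)
    \<longleftrightarrow> uniform_growth (\<lambda>k. scaled_weight (- k)) UNIV"
proof -
  obtain D where D: "\<And>k. scaled_weight (k + 1) \<le> D * scaled_weight k"
    "\<And>k. scaled_weight k \<le> D * scaled_weight (k + 1)"
    using scaled_weight_ratio_bounded by blast
  have D': "scaled_weight (- (k + 1)) \<le> D * scaled_weight (- k)"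
    "scaled_weight (- k) \<le> D * scaled_weight (- (k + 1))" for k
    using D(2)[of "- (k + 1)"] D(1)[of "- (k + 1)"] by simp_all
  have reindex: "range (\<lambda>k. h (- k - int n)) = range h" for h :: "int \<Rightarrow> ereal" and n
  proof -
    have "h k \<in> range (\<lambda>k. h (- k - int n))" for k
      by (rule range_eqI[of _ _ "- k - int n"]) simp
    then show ?thesis by blast
  qed
  have "(SUP k::int. ereal ((scaled_weight (k + int n) / scaled_weight k) powr (1 / real n))) =
      (SUP k::int. ereal ((scaled_weight (- k) / scaled_weight (- (k + int n))) powr (1 / real n)))" for n
    using reindex[of "\<lambda>k. ereal ((scaled_weight (k + int n) / scaled_weight k) powr (1 / real n))" n]
    by simp
  then show ?thesis
    unfolding weight_product_scaled_weight
    using lim_SUP_less_1_iff_uniform_growth[of "\<lambda>k. scaled_weight (- k)" D UNIV] scaled_weight_pos D'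
    by simp
qed

lemma lim_SUP_left_iff:
  "(\<exists>L<1. (\<lambda>n::nat. SUP k\<in>{1::int..}. ereal ((norm (\<Prod>j\<in>{- k - int n..- k - 1}. w j) *
      (nrm (unit_seq (- k - int n)) / nrm (unit_seq (- k)))) powr (1 / real n))) \<longlonglongrightarrow> L)
    \<longleftrightarrow> uniform_growth (\<lambda>k. scaled_weight (- k)) {1..}"
proof -
  obtain D where D: "\<And>k. scaled_weight (k + 1) \<le> D * scaled_weight k"
    "\<And>k. scaled_weight k \<le> D * scaled_weight (k + 1)"
    using scaled_weight_ratio_bounded by blast
  have D': "scaled_weight (- (k + 1)) \<le> D * scaled_weight (- k)"
    "scaled_weight (- k) \<le> D * scaled_weight (- (k + 1))" for k
    using D(2)[of "- (k + 1)"] D(1)[of "- (k + 1)"] by simp_all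
  have "norm (\<Prod>j\<in>{- k - int n..- k - 1}. w j) * (nrm (unit_seq (- k - int n)) / nrm (unit_seq (- k))) =
      scaled_weight (- k) / scaled_weight (- (k + int n))" for k n
    using weight_product_scaled_weight[of "- k - int n" n] by simp
  then show ?thesis
    using lim_SUP_less_1_iff_uniform_growth[of "\<lambda>k. scaled_weight (- k)" D "{1..}"] scaled_weight_pos D'
    by simp
qed

lemma lim_INF_iff:
  assumes "A \<noteq> {}" and "\<And>k n. k \<in> A \<Longrightarrow> k + int n \<in> A"
  shows "(\<exists>L>1. (\<lambda>n::nat. INF k\<in>A. ereal ((norm (\<Prod>j\<in>{k..k + int n - 1}. w j) *
      (nrm (unit_seq k) / nrm (unit_seq (k + int n)))) powr (1 / real n))) \<longlonglongrightarrow> L)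
    \<longleftrightarrow> uniform_growth scaled_weight A"
proof -
  obtain D where D: "\<And>k. scaled_weight (k + 1) \<le> D * scaled_weight k"
    "\<And>k. scaled_weight k \<le> D * scaled_weight (k + 1)"
    using scaled_weight_ratio_bounded by blast
  show ?thesis
    unfolding weight_product_scaled_weight
    using lim_INF_greater_1_iff_uniform_growth[of scaled_weight D A] scaled_weight_pos D assms
    by blast
qed

end

theorem theorem18:
  fixes w :: "int \<Rightarrow> 'k::real_normed_field"
    and X :: "(int \<Rightarrow> 'k) set"
    and nrm :: "(int \<Rightarrow> 'k) \<Rightarrow> real"
  assumes "\<And>n. w n \<noteq> 0"
    and "admissible_sequence_space w X nrm"
  shows "shadowing_property X (norm_dist X nrm) (weighted_shift w) \<longleftrightarrow>
    (\<exists>L<1. (\<lambda>n::nat. SUP k::int. ereal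
        ((norm (\<Prod>j\<in>{k..k + int n - 1}. w j) *
          (nrm (unit_seq k) / nrm (unit_seq (k + int n)))) powr (1 / real n))) \<longlonglongrightarrow> L) \<or>
    (\<exists>L>1. (\<lambda>n::nat. INF k::int. ereal
        ((norm (\<Prod>j\<in>{k..k + int n - 1}. w j) *
          (nrm (unit_seq k) / nrm (unit_seq (k + int n)))) powr (1 / real n))) \<longlonglongrightarrow> L) \<or>
    ((\<exists>L<1. (\<lambda>n::nat. SUP k\<in>{1::int..}. ereal
        ((norm (\<Prod>j\<in>{- k - int n..- k - 1}. w j) *
          (nrm (unit_seq (- k - int n)) / nrm (unit_seq (- k)))) powr (1 / real n))) \<longlonglongrightarrow> L) \<and>
     (\<exists>L>1. (\<lambda>n::nat. INF k\<in>{1::int..}. ereal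
        ((norm (\<Prod>j\<in>{k..k + int n - 1}. w j) *
          (nrm (unit_seq k) / nrm (unit_seq (k + int n)))) powr (1 / real n))) \<longlonglongrightarrow> L))"
proof -
  interpret nonzero_weighted_shift w X nrm
    by (intro nonzero_weighted_shift.intro nonzero_weighted_shift_axioms.intro assms)
  have "(1::int) \<in> {1..}" by simp
  then show ?thesis
    unfolding lim_SUP_all_iff lim_SUP_left_iff
    by (subst (1 2) lim_INF_iff) (auto simp: shadowing_iff_growth)
qed

end
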